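(* There exists a Lipschitz function $F_0:[0,\infty)\to[0,\infty)$ satisfying (i) $0\le F_0(x)\le x$ for all $x\ge 0$, $F_0$ is sublinear, and $0\le\partial_xF_0\le1$ a.e. on $[0,\infty)$; (ii) $$0<\liminf_{x\to\infty}\frac{F_0(x)}{x^{2/3}}<\limsup_{x\to\infty}\frac{F_0(x)}{x^{2/3}}<\infty,$$ such that, if $F$ denotes the unique viscosity solution of $$\begin{cases}\partial_tF+\tfrac12(\partial_xF-1)(\partial_xF-2)+\dfrac Fx-1=0&\text{in }(0,\infty)^2,\\ 0\le F(x,t)\le x&\text{on }[0,\infty)^2,\\ F(x,0)=F_0(x)&\text{on }[0,\infty),\end{cases}$$ then for some $x_0>0$ the limit $\lim_{t\to\infty}F(x_0,t)$ does not exist.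
   Context: A function $g$ on $[0,\infty)$ is sublinear if $\lim_{x\to\infty}g(x)/x=0$. Solutions are continuous on $[0,\infty)^2$ and are understood in the viscosity sense, with $F=F(x,t)$, $x$ the space variable and $t$ the time variable. Under assumption (i) on $F_0$, the problem has a unique (sublinear in $x$) viscosity solution $F$, which is known to be globally Lipschitz and to satisfy $0\le\partial_xF\le1$ a.e. on $[0,\infty)^2$. *)

theory Defs
  imports "HOL-Analysis.Analysis"
begin

definition sublinear :: "(real \<Rightarrow> real) \<Rightarrow> bool" where
  "sublinear g \<longleftrightarrow> ((\<lambda>x. g x / x) \<longlongrightarrow> 0) at_top"

text \<open>Points of the plane are pairs (x, t) of a space and a time variable. A function on
  a subset of the line or of the plane is a total function whose values elsewhere are ignored.\<close>

definition C1_with_partials ::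
    "(real \<times> real) set \<Rightarrow> (real \<times> real \<Rightarrow> real) \<Rightarrow> (real \<times> real \<Rightarrow> real) \<Rightarrow> (real \<times> real \<Rightarrow> real) \<Rightarrow> bool" where
  "C1_with_partials U \<phi> \<phi>x \<phi>t \<longleftrightarrow>
     continuous_on U \<phi>x \<and> continuous_on U \<phi>t \<and>
     (\<forall>z\<in>U. (\<phi> has_derivative (\<lambda>(h, k). \<phi>x z * h + \<phi>t z * k)) (at z))"

text \<open>The equation is written E(z, u(z), u_x(z), u_t(z)) = 0 on the open set U.
  Touching is local, and the definitions are meant for continuous u, so no semicontinuous
  envelopes appear.\<close>

definition viscosity_subsolution ::
    "(real \<times> real \<Rightarrow> real \<Rightarrow> real \<Rightarrow> real \<Rightarrow> real) \<Rightarrow> (real \<times> real) set \<Rightarrow> (real \<times> real \<Rightarrow> real) \<Rightarrow> bool" where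
  "viscosity_subsolution E U u \<longleftrightarrow>
     (\<forall>\<phi> \<phi>x \<phi>t. C1_with_partials U \<phi> \<phi>x \<phi>t \<longrightarrow>
        (\<forall>z\<in>U. (\<forall>\<^sub>F w in nhds z. u w - \<phi> w \<le> u z - \<phi> z) \<longrightarrow> E z (u z) (\<phi>x z) (\<phi>t z) \<le> 0))"

definition viscosity_supersolution ::
    "(real \<times> real \<Rightarrow> real \<Rightarrow> real \<Rightarrow> real \<Rightarrow> real) \<Rightarrow> (real \<times> real) set \<Rightarrow> (real \<times> real \<Rightarrow> real) \<Rightarrow> bool" where
  "viscosity_supersolution E U u \<longleftrightarrow>
     (\<forall>\<phi> \<phi>x \<phi>t. C1_with_partials U \<phi> \<phi>x \<phi>t \<longrightarrow>
        (\<forall>z\<in>U. (\<forall>\<^sub>F w in nhds z. u w - \<phi> w \<ge> u z - \<phi> z) \<longrightarrow> E z (u z) (\<phi>x z) (\<phi>t z) \<ge> 0))"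

definition cf_operator :: "real \<times> real \<Rightarrow> real \<Rightarrow> real \<Rightarrow> real \<Rightarrow> real" where
  "cf_operator z u p q = q + 1/2 * (p - 1) * (p - 2) + u / fst z - 1"

text \<open>Sublinearity in x, at each fixed time, belongs to the class of solutions in which
  uniqueness is asserted.\<close>

definition cf_solution :: "(real \<Rightarrow> real) \<Rightarrow> (real \<times> real \<Rightarrow> real) \<Rightarrow> bool" where
  "cf_solution F0 F \<longleftrightarrow>
     continuous_on ({0..} \<times> {0..}) F \<and>
     viscosity_subsolution cf_operator ({0<..} \<times> {0<..}) F \<and>
     viscosity_supersolution cf_operator ({0<..} \<times> {0<..}) F \<and>
     (\<forall>x\<ge>0. \<forall>t\<ge>0. 0 \<le> F (x, t) \<and> F (x, t) \<le> x) \<and>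
     (\<forall>t\<ge>0. sublinear (\<lambda>x. F (x, t))) \<and>
     (\<forall>x\<ge>0. F (x, 0) = F0 x)"

end

theory Submission imports Defs begin

text \<open>
  Expanding the Hamiltonian turns the equation into
  \<open>F_t + F_x\<^sup>2 / 2 - 3 F_x / 2 + F / x = 0\<close>.
  For large \<open>x\<close> the slope is small and what remains is the transport equation
  \<open>F_t - 3 F_x / 2 + F / x = 0\<close>, solved by \<open>x powr (2/3) * \<phi> (x + 3 t / 2)\<close>.
  So the ratio \<open>F / x powr (2/3)\<close> far out is carried to bounded \<open>x\<close> without being damped.
  The stationary sublinear solutions form a family indexed by a parameter \<open>g\<close>,
  namely \<open>x = a (g + a)\<^sup>2\<close>, \<open>F = a g\<^sup>2 + 3 g a\<^sup>2 / 2\<close>, with \<open>F\<close> asymptotic to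
  \<open>3 g / 2 * x powr (2/3)\<close>. If the ratio in the initial datum oscillates, more and more slowly,
  then the solution at \<open>x = 1\<close> follows this family with a parameter that never settles.

  To make this exact, the solution is built from its characteristics. The characteristic system
  has the following integral: let \<open>y\<close> solve \<open>y'' = - (w / 4) y\<close>, \<open>y 0 = g\<close>, \<open>y' 0 = 1\<close>, and put
  \<open>x = a y\<^sup>2\<close>, \<open>t = \<tau> - 2 (\<integral> y\<^sup>2 from 0 to a)\<close>, \<open>F_x = 1 - a y' / y\<close>, \<open>F_t = w a\<^sup>2 / 8\<close>;
  the equation itself then gives \<open>F\<close>. As \<open>a\<close> decreases to 0 the point moves to the left
  and leaves the quadrant at \<open>x = 0\<close> at the time \<open>\<tau>\<close>. A family of such curves, with \<open>g\<close> and \<open>w\<close>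
  depending on \<open>\<tau>\<close>, fits together to the graph of a function exactly if \<open>dF - F_x dx - F_t dt\<close>
  vanishes across the curves as well, and this condition is \<open>w = 12 g'\<close>
  (\<open>contact_across\<close>, a Wronskian identity). Hence \<open>g\<close> may be prescribed. With
  \<open>g \<tau> = 2 + slow * sin (ln \<tau>)\<close> the frequency \<open>w\<close> is \<open>O(1 / \<tau>)\<close>, while \<open>a\<close> is \<open>O(\<tau> powr (1/3))\<close>
  on the part of the curves with \<open>t > 1\<close>; there all quantities stay close to the stationary ones,
  the curves do not cross and they cover the region (\<open>char_param_inj\<close>, \<open>char_param_surj\<close>).
  This yields a continuously differentiable solution.

  Uniqueness is then easy, since any competitor is compared with a C1 function: that function plus
  a small penalty serves as the test function, and no doubling of variables is needed
  (\<open>subsolution_le\<close>, \<open>supersolution_ge\<close>). Finally \<open>F (x, 0) / x powr (2/3)\<close> differs from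
  \<open>3 g / 2\<close> by a quantity tending to 0 (\<open>far_field\<close>), and convergence of \<open>F (1, t)\<close> would force
  \<open>g\<close> to converge (\<open>no_limit\<close>).
\<close>

section \<open>Stumpff functions and universal functions\<close>

text \<open>The power series of \<open>cos (sqrt z)\<close> (\<open>k = 0\<close>) and \<open>sin (sqrt z) / sqrt z\<close> (\<open>k = 1\<close>) and of their
  iterated remainders. They are entire in \<open>z\<close>, so oscillating and exponential behaviour are treated
  at once; this matters because the frequency below changes sign infinitely often.\<close>
definition stumpff :: "nat \<Rightarrow> real \<Rightarrow> real" where
  "stumpff k z = (\<Sum>n. (-1) ^ n / fact (2 * n + k) * z ^ n)"

lemma stumpff_term_bound: "\<bar>(-1) ^ n / fact (2 * n + k) * z ^ n\<bar> \<le> \<bar>z\<bar> ^ n /\<^sub>R fact n" for z :: real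
proof -
  have "(fact n :: real) \<le> fact (2 * n + k)" by (intro fact_mono) simp
  then show ?thesis
    by (simp add: abs_mult power_abs field_simps)
      (metis abs_ge_zero mult.commute mult_left_mono zero_le_power)
qed

lemma stumpff_summable: "summable (\<lambda>n. (-1) ^ n / fact (2 * n + k) * z ^ n)" for z :: real
  by (rule summable_comparison_test'[where g = "\<lambda>n. \<bar>z\<bar> ^ n /\<^sub>R fact n" and N = 0])
    (use summable_exp_generic[of "\<bar>z\<bar>"] stumpff_term_bound in \<open>simp_all\<close>)

lemma abs_stumpff_le:
  assumes "\<bar>z\<bar> \<le> 1"
  shows "\<bar>stumpff k z\<bar> \<le> 3"
proof -
  have "\<bar>stumpff k z\<bar> \<le> (\<Sum>n. \<bar>z\<bar> ^ n /\<^sub>R fact n)"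
    unfolding stumpff_def real_norm_def[symmetric]
    by (rule norm_suminf_le)
      (use stumpff_term_bound summable_exp_generic[of "\<bar>z\<bar>"] in \<open>auto simp: \<close>)
  also have "\<dots> = exp \<bar>z\<bar>" by (simp add: exp_def)
  also have "\<dots> \<le> exp 1" using assms by simp
  also have "\<dots> \<le> 3" using exp_le by simp
  finally show ?thesis .
qed

lemma stumpff_0: "stumpff k 0 = 1 / fact k"
proof -
  have "(\<lambda>n. (-1) ^ n / fact (2 * n + k) * 0 ^ n) sums ((-1) ^ 0 / fact (2 * 0 + k) :: real)"
    by (rule powser_sums_zero)
  then show ?thesis unfolding stumpff_def by (simp add: sums_iff)
qed

lemma stumpff_rec: "z * stumpff (k + 2) z = 1 / fact k - stumpff k z"
proof -
  have "stumpff k z = 1 / fact k + (\<Sum>n. (-1) ^ Suc n / fact (2 * Suc n + k) * z ^ Suc n)"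
    using suminf_split_head[OF stumpff_summable[of k z]] by (simp add: stumpff_def)
  also have "(\<Sum>n. (-1) ^ Suc n / fact (2 * Suc n + k) * z ^ Suc n)
      = (\<Sum>n. (- z) * ((-1) ^ n / fact (2 * n + (k + 2)) * z ^ n))"
  proof (intro arg_cong[where f = suminf] ext)
    fix n :: nat
    have "2 * Suc n + k = 2 * n + (k + 2)" by simp
    then show "(-1) ^ Suc n / fact (2 * Suc n + k) * z ^ Suc n
      = (- z) * ((-1) ^ n / fact (2 * n + (k + 2)) * z ^ n)"
      by (simp only:) simp
  qed
  also have "\<dots> = - z * stumpff (k + 2) z"
    unfolding stumpff_def by (rule suminf_mult[OF stumpff_summable])
  finally show ?thesis by simp
qed

lemma DERIV_stumpff:
  "(stumpff k has_field_derivative (real k * stumpff (k + 2) z - stumpff (k + 1) z) / 2) (at z)"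
proof -
  let ?c = "\<lambda>k n. (-1) ^ n / fact (2 * n + k) :: real"
  have D: "((\<lambda>z. \<Sum>n. ?c k n * z ^ n) has_field_derivative (\<Sum>n. diffs (?c k) n * z ^ n)) (at z)"
    by (rule termdiffs_strong_converges_everywhere) (rule stumpff_summable)
  have E: "diffs (?c k) n * z ^ n = (real k / 2) * (?c (k + 2) n * z ^ n) - 1/2 * (?c (k + 1) n * z ^ n)" for n
  proof -
    have f: "fact (2 * Suc n + k) = (2 * real n + k + 2) * fact (2 * n + (k + 1))"
      "fact (2 * n + (k + 2)) = (2 * real n + k + 2) * fact (2 * n + (k + 1))"
      by (simp_all add: algebra_simps)
    define c :: real where "c = fact (2 * n + (k + 1))"
    have "c > 0" "2 * real n + k + 2 > 0" by (simp_all add: c_def)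
    then show ?thesis
      unfolding diffs_def f c_def[symmetric] by (simp add: divide_simps) (simp add: algebra_simps)
  qed
  have S: "(\<Sum>n. (real k / 2) * (?c (k + 2) n * z ^ n) - 1/2 * (?c (k + 1) n * z ^ n))
     = (real k / 2) * stumpff (k + 2) z - 1/2 * stumpff (k + 1) z"
    unfolding stumpff_def
    by (subst suminf_diff[OF summable_mult[OF stumpff_summable] summable_mult[OF stumpff_summable], symmetric])
      (simp only: suminf_mult[OF stumpff_summable])
  show ?thesis
    using D unfolding E S by (simp add: stumpff_def[of k, abs_def] diff_divide_distrib)
qed

text \<open>The universal functions of the Kepler problem: \<open>ufun 0\<close> and \<open>ufun 1\<close> are the solutions of
  \<open>y'' = - w y\<close> with data \<open>(1, 0)\<close> and \<open>(0, 1)\<close>, and each further one integrates its predecessor.\<close>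
definition ufun :: "nat \<Rightarrow> real \<Rightarrow> real \<Rightarrow> real" where
  "ufun k w a = a ^ k * stumpff k (w * a\<^sup>2)"

text \<open>The derivative in the frequency; differentiating the Stumpff series only raises the index.\<close>
definition ufun_w :: "nat \<Rightarrow> real \<Rightarrow> real \<Rightarrow> real" where
  "ufun_w k w a = (real k * ufun (k + 2) w a - a * ufun (k + 1) w a) / 2"

lemma ufun_at_0: "ufun 0 w 0 = 1" "k > 0 \<Longrightarrow> ufun k w 0 = 0"
  by (simp_all add: ufun_def stumpff_0)

lemma ufun_rec: "w * ufun (k + 2) w a = a ^ k / fact k - ufun k w a"
  using arg_cong[OF stumpff_rec[of "w * a\<^sup>2" k], of "\<lambda>s. a ^ k * s"]
  by (simp add: ufun_def algebra_simps power2_eq_square)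

lemma abs_ufun_le:
  assumes "\<bar>w * a\<^sup>2\<bar> \<le> 1" "a \<ge> 0"
  shows "\<bar>ufun k w a\<bar> \<le> 3 * a ^ k"
  using mult_left_mono[OF abs_stumpff_le[OF assms(1), of k], of "a ^ k"] assms(2)
  by (simp add: ufun_def abs_mult)

lemma DERIV_ufun:
  "(ufun (Suc k) w has_field_derivative ufun k w a) (at a)"
  "(ufun 0 w has_field_derivative - w * ufun 1 w a) (at a)"
proof -
  have "((\<lambda>a. a ^ Suc k * stumpff (Suc k) (w * a\<^sup>2)) has_field_derivative
    a ^ k * (real (Suc k) * stumpff (Suc k) (w * a\<^sup>2) + real (Suc k) * (w * a\<^sup>2 * stumpff (Suc k + 2) (w * a\<^sup>2))
       - w * a\<^sup>2 * stumpff (k + 2) (w * a\<^sup>2))) (at a)"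
    by (rule derivative_eq_intros DERIV_chain2[OF DERIV_stumpff] refl)+
      (simp add: field_simps power2_eq_square)
  moreover have "real (Suc k) * stumpff (Suc k) z + real (Suc k) * (z * stumpff (Suc k + 2) z)
       - z * stumpff (k + 2) z = stumpff k z" for z
  proof -
    have "real (Suc k) * stumpff (Suc k) z + real (Suc k) * (z * stumpff (Suc k + 2) z)
      = real (Suc k) / fact (Suc k)"
      unfolding stumpff_rec by (simp add: right_diff_distrib del: fact_Suc of_nat_Suc)
    also have "\<dots> = 1 / fact k" by (simp add: divide_simps)
    finally show ?thesis unfolding stumpff_rec by simp
  qed
  ultimately show "(ufun (Suc k) w has_field_derivative ufun k w a) (at a)"
    by (simp only: ufun_def[abs_def])
  show "(ufun 0 w has_field_derivative - w * ufun 1 w a) (at a)"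
    unfolding ufun_def[abs_def]
    by (rule derivative_eq_intros DERIV_chain2[OF DERIV_stumpff] refl)+
      (simp add: algebra_simps power2_eq_square)
qed

lemma ufun_has_derivative:
  assumes "(w has_field_derivative w') (at (snd z))"
  shows "((\<lambda>z. ufun (Suc k) (w (snd z)) (fst z)) has_derivative
     (\<lambda>h. ufun k (w (snd z)) (fst z) * fst h + w' * ufun_w (Suc k) (w (snd z)) (fst z) * snd h)) (at z)"
    "((\<lambda>z. ufun 0 (w (snd z)) (fst z)) has_derivative
     (\<lambda>h. - w (snd z) * ufun 1 (w (snd z)) (fst z) * fst h + w' * ufun_w 0 (w (snd z)) (fst z) * snd h)) (at z)"
proof -
  have gen: "((\<lambda>z. ufun k (w (snd z)) (fst z)) has_derivative
     (\<lambda>h. D * fst h + w' * ufun_w k (w (snd z)) (fst z) * snd h)) (at z)"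
    if D: "(ufun k (w (snd z)) has_field_derivative D) (at (fst z))" for k D
  proof -
    let ?s = "w (snd z) * (fst z)\<^sup>2"
    let ?S = "(real k * stumpff (k + 2) ?s - stumpff (k + 1) ?s) / 2"
    have ws: "((\<lambda>z. w (snd z)) has_derivative (\<lambda>h. w' * snd h)) (at z)"
      using has_derivative_compose[OF has_derivative_snd[OF has_derivative_ident] assms[unfolded has_field_derivative_def]]
      by simp
    have st: "((\<lambda>z. stumpff k (w (snd z) * (fst z)\<^sup>2)) has_derivative
       (\<lambda>h. ?S * (w (snd z) * (2 * fst z * fst h) + w' * snd h * (fst z)\<^sup>2))) (at z)"
      by (rule has_derivative_compose[OF _ DERIV_stumpff[unfolded has_field_derivative_def], THEN has_derivative_eq_rhs])
        (auto intro!: derivative_eq_intros ws)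
    have pw: "((\<lambda>z. fst z ^ k) has_derivative (\<lambda>h. real k * fst h * fst z ^ (k - 1))) (at z)"
      by (auto intro!: derivative_eq_intros simp: algebra_simps)
    have eD: "D = real k * fst z ^ (k - 1) * stumpff k ?s + fst z ^ k * (?S * (w (snd z) * (2 * fst z)))"
      by (rule DERIV_unique[OF D], unfold ufun_def[abs_def])
        (rule derivative_eq_intros DERIV_chain2[OF DERIV_stumpff] refl | simp)+
    have eU: "ufun_w k (w (snd z)) (fst z) = fst z ^ k * (fst z)\<^sup>2 * ?S"
      by (simp add: ufun_w_def ufun_def power_add power2_eq_square algebra_simps diff_divide_distrib)
    show ?thesis
      unfolding ufun_def[of k, abs_def] eD eU
      by (rule has_derivative_eq_rhs[OF has_derivative_mult[OF pw st]], rule ext, simp add: field_simps power2_eq_square)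
  qed
  show "((\<lambda>z. ufun (Suc k) (w (snd z)) (fst z)) has_derivative
     (\<lambda>h. ufun k (w (snd z)) (fst z) * fst h + w' * ufun_w (Suc k) (w (snd z)) (fst z) * snd h)) (at z)"
    by (rule gen[OF DERIV_ufun(1)])
  show "((\<lambda>z. ufun 0 (w (snd z)) (fst z)) has_derivative
     (\<lambda>h. - w (snd z) * ufun 1 (w (snd z)) (fst z) * fst h + w' * ufun_w 0 (w (snd z)) (fst z) * snd h)) (at z)"
    by (rule gen[OF DERIV_ufun(2)])
qed

lemma zero_derivative_eq_0:
  fixes f :: "real \<Rightarrow> real"
  assumes "\<And>a. (f has_field_derivative 0) (at a)" "f 0 = 0"
  shows "f a = 0"
  using DERIV_isconst_all[of f a 0] assms by auto

lemma DERIV_ufun_numeral: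
  "(ufun 1 w has_field_derivative ufun 0 w a) (at a)"
  "(ufun 2 w has_field_derivative ufun 1 w a) (at a)"
  "(ufun 3 w has_field_derivative ufun 2 w a) (at a)"
  "(ufun 4 w has_field_derivative ufun 3 w a) (at a)"
  using DERIV_ufun(1)[of 0 w a] DERIV_ufun(1)[of 1 w a] DERIV_ufun(1)[of 2 w a] DERIV_ufun(1)[of 3 w a]
  by (simp_all add: eval_nat_numeral)

lemma ufun_rec_numeral:
  "w * ufun 2 w a = 1 - ufun 0 w a"
  "w * ufun 3 w a = a - ufun 1 w a"
  "w * ufun 4 w a = a\<^sup>2 / 2 - ufun 2 w a"
  "w * ufun 5 w a = a ^ 3 / 6 - ufun 3 w a"
  "w * ufun 6 w a = a ^ 4 / 24 - ufun 4 w a"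
  using ufun_rec[of w 0 a] ufun_rec[of w 1 a] ufun_rec[of w 2 a] ufun_rec[of w 3 a] ufun_rec[of w 4 a]
  by (simp_all add: fact_numeral flip: numeral_2_eq_2 numeral_3_eq_3)

lemma ufun1_square: "(ufun 1 w a)\<^sup>2 = 2 * ufun 2 w a - w * (ufun 2 w a)\<^sup>2"
proof -
  have "((\<lambda>a. (ufun 1 w a)\<^sup>2 - (2 * ufun 2 w a - w * (ufun 2 w a)\<^sup>2)) has_field_derivative 0) (at a)" for a
  proof -
    have "2 * ufun 1 w a * ufun 0 w a - (2 * ufun 1 w a - w * (2 * ufun 2 w a * ufun 1 w a)) = 0"
      using ufun_rec_numeral(1)[of w a] by algebra
    then show ?thesis
      by - ((rule derivative_eq_intros DERIV_ufun_numeral refl)+, simp add: mult_ac)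
  qed
  from zero_derivative_eq_0[OF this, of a] show ?thesis by (simp add: ufun_at_0)
qed

text \<open>The quadratic relation among the universal functions that does not follow from the recursion
  and \<open>ufun1_square\<close> by algebra, because it arises from those after a division by \<open>w\<close>.
  It is proved by differentiation in \<open>a\<close>.\<close>
lemma ufun2_square: "(ufun 2 w a)\<^sup>2 + 2 * ufun 4 w a = (a + ufun 1 w a) * ufun 3 w a"
proof -
  have "((\<lambda>a. (ufun 2 w a)\<^sup>2 + 2 * ufun 4 w a - (a + ufun 1 w a) * ufun 3 w a) has_field_derivative 0) (at a)" for a
  proof -
    have "2 * ufun 2 w a * ufun 1 w a + 2 * ufun 3 w a - ((a + ufun 1 w a) * ufun 2 w a + (1 + ufun 0 w a) * ufun 3 w a) = 0"
      using ufun_rec_numeral(1,2)[of w a] by algebra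
    then show ?thesis
      by - ((rule derivative_eq_intros DERIV_ufun_numeral refl)+, simp add: mult_ac add_ac)
  qed
  from zero_derivative_eq_0[OF this, of a] show ?thesis by (simp add: ufun_at_0)
qed

text \<open>The Wronskian identity below is linear in the derivatives of \<open>g\<close> and \<open>w\<close>. This lemma and the next
  one are its two coefficients, as polynomial identities modulo the relations between the
  universal functions.\<close>
lemma wronskian_amp_coeff:
  assumes "w * U2 = 1 - U0" "U1\<^sup>2 = 2 * U2 - w * U2\<^sup>2"
  shows "((g::real) * U0 + U1 - g\<^sup>2 * w * U1 / 4) * (g * (1 + U0) + 2 * U1)
     - (g\<^sup>2 * (1 + U0) / 2 + 2 * g * U1 + 2 * U2) * (U0 - g * w * U1 / 2)
     = g\<^sup>2 * (1 + U0) / 2 + 2 * g * U1 + 2 * U2"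
  using assms by algebra

lemma wronskian_freq_coeff:
  fixes g a w U0 U1 U2 U3 U4 :: real
  assumes h: "w * U2 = 1 - U0" "U1\<^sup>2 = 2 * U2 - w * U2\<^sup>2"
    "w * U3 = a - U1" "w * U4 = a\<^sup>2 / 2 - U2" "U2\<^sup>2 + 2 * U4 = (a + U1) * U3"
   "D0 = - a * U1 / 2" "D1 = (U3 - a * U2) / 2" "D2 = (2 * U4 - a * U3) / 2"
  shows "(g * U0 + U1 - g\<^sup>2 * w * U1 / 4) * (g\<^sup>2 * D0 / 2 + 2 * g * D1 + 2 * D2)
     - (g\<^sup>2 * (1 + U0) / 2 + 2 * g * U1 + 2 * U2) * (g * D0 + D1 - g\<^sup>2 * U1 / 4 - g\<^sup>2 * w * D1 / 4)
     = (g\<^sup>2 * (1 + U0) / 2 + 2 * g * U1 + 2 * U2) * (g\<^sup>2 * (a + U1) / 2 + 2 * g * U2 + 2 * U3) / 4" (is "?L = ?R")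
proof -
  (* Both sides are polynomials in g; the fact ci compares the coefficients of g^i. *)
  have c0: "U1 * (2 * D2) - 2 * U2 * D1 = U2 * U3"
  proof -
    have "2 * U4 * (U1 - a) = - 2 * U4 * w * U3" using h(3) by algebra
    moreover have "2 * U3 * (a\<^sup>2/2 - U2) = 2 * U4 * w * U3" using h(4) by algebra
    ultimately show ?thesis unfolding h(6-8) using h(5) by algebra
  qed
  have c1: "2 * U0 * D2 - 2 * U2 * D0 = U2\<^sup>2 + U1 * U3"
  proof -
    have "w * a * U2 * U3 = a\<^sup>2 * U2 - a * U1 * U2" using h(3) by algebra
    moreover have "w * U2 * U4 = U2 * (a\<^sup>2/2 - U2)" using h(4) by algebra
    moreover have "U0 = 1 - w * U2" using h(1) by simp
    ultimately show ?thesis unfolding h(6-8) using h(5) by algebra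
  qed
  have c3: "U0 * D0 / 2 - w * U1 / 4 * (2 * D1) - ((1 + U0) / 2 * D0 - 2 * U1 * (U1 / 4 + w * D1 / 4))
    = ((1 + U0) * U2 + U1 * (a + U1)) / 4"
  proof -
    have "(1 + U0) * U2 = U1\<^sup>2" using h(1,2) by algebra
    then show ?thesis unfolding h(6-8) by (simp add: field_simps power2_eq_square)
  qed
  have c4: "- w * U1 / 4 * D0 / 2 + (1 + U0) / 2 * (U1 / 4 + w * D1 / 4) = (1 + U0) / 2 * ((a + U1) / 2) / 4"
  proof -
    have "(1 + U0) * U2 = U1\<^sup>2" using h(1,2) by algebra
    (* The relations, weighted with the cofactors that represent the difference of both sides. *)
    then have e: "w * a * (U1\<^sup>2 - (1 + U0) * U2) / 16 + (1 + U0) / 16 * (w * U3 - (a - U1)) = 0"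
      using h(3) by simp
    show ?thesis unfolding h(6-8) using e by (simp add: field_simps power2_eq_square)
  qed
  have c2: "U1 * D0 / 2 + 2 * U0 * D1 - w * U1 / 4 * (2 * D2) - ((1 + U0) / 2 * D1 + 2 * U1 * D0 - 2 * U2 * (U1/4 + w * D1 / 4))
    = ((1 + U0) / 2 * (2 * U3) + 2 * U1 * (2 * U2) + 2 * U2 * ((a + U1) / 2)) / 4"
  proof -
    have "(1 + U0) * U2 = U1\<^sup>2" using h(1,2) by algebra
    (* The relations, weighted with the cofactors that represent the difference of both sides. *)
    then have e: "- (U1 / 4) * (2 * (w * U4 - (a\<^sup>2 / 2 - U2)) - a * (w * U3 - (a - U1)))
       + (U3 - a * U2) / 4 * (w * U2 - (1 - U0)) + a / 2 * (U1\<^sup>2 - (1 + U0) * U2)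
       + U3 / 4 * (w * U2 - (1 - U0)) - U2 / 4 * (w * U3 - (a - U1)) = 0"
      using h(1,3,4) by simp
    show ?thesis unfolding h(6-8) using e by (simp add: field_simps power2_eq_square)
  qed
  have "?L - ?R = (U1 * (2 * D2) - 2 * U2 * D1 - U2 * U3)
    + g * (2 * U0 * D2 - 2 * U2 * D0 - (U2\<^sup>2 + U1 * U3))
    + g\<^sup>2 * (U1 * D0 / 2 + 2 * U0 * D1 - w * U1 / 4 * (2 * D2) - ((1 + U0) / 2 * D1 + 2 * U1 * D0 - 2 * U2 * (U1/4 + w * D1 / 4))
       - ((1 + U0) / 2 * (2 * U3) + 2 * U1 * (2 * U2) + 2 * U2 * ((a + U1) / 2)) / 4)
    + g ^ 3 * (U0 * D0 / 2 - w * U1 / 4 * (2 * D1) - ((1 + U0) / 2 * D0 - 2 * U1 * (U1 / 4 + w * D1 / 4))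
       - ((1 + U0) * U2 + U1 * (a + U1)) / 4)
    + g ^ 4 * (- w * U1 / 4 * D0 / 2 + (1 + U0) / 2 * (U1 / 4 + w * D1 / 4) - (1 + U0) / 2 * ((a + U1) / 2) / 4)"
    by (simp add: field_simps power2_eq_square power3_eq_cube power4_eq_xxxx)
  then show ?thesis unfolding c0 c1 c2 c3 c4 by simp
qed

section \<open>The squared oscillator along a characteristic\<close>

text \<open>With \<open>y'' = - (w / 4) y\<close>, \<open>y 0 = g\<close> and \<open>y' 0 = 1\<close>, the next three functions are \<open>y\<^sup>2\<close>, \<open>y y'\<close>
  and the integral of \<open>y\<^sup>2\<close> from 0. By the double angle formulas quadratic expressions in \<open>y\<close> are
  linear in the universal functions of the fourfold frequency \<open>w\<close>, so \<open>y\<close> itself never occurs.\<close>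
definition ysq :: "real \<Rightarrow> real \<Rightarrow> real \<Rightarrow> real" where
  "ysq g w a = g\<^sup>2 * (1 + ufun 0 w a) / 2 + 2 * g * ufun 1 w a + 2 * ufun 2 w a"

definition ydy :: "real \<Rightarrow> real \<Rightarrow> real \<Rightarrow> real" where
  "ydy g w a = g * ufun 0 w a + ufun 1 w a - g\<^sup>2 * w * ufun 1 w a / 4"

definition yint :: "real \<Rightarrow> real \<Rightarrow> real \<Rightarrow> real" where
  "yint g w a = g\<^sup>2 * (a + ufun 1 w a) / 2 + 2 * g * ufun 2 w a + 2 * ufun 3 w a"

text \<open>The conserved quantity \<open>y'\<^sup>2 + (w / 4) y\<^sup>2\<close>.\<close>
definition energy :: "real \<Rightarrow> real \<Rightarrow> real" where
  "energy g w = 1 + w * g\<^sup>2 / 4"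

text \<open>The value of the solution, obtained by solving the equation for \<open>F\<close> and eliminating \<open>y'\<^sup>2\<close>
  with the energy.\<close>
definition uval :: "real \<Rightarrow> real \<Rightarrow> real \<Rightarrow> real" where
  "uval g w a = a * ysq g w a - a\<^sup>2 * ydy g w a / 2 - a ^ 3 * energy g w / 2"

text \<open>The suffix \<open>_t\<close> marks derivatives in the parameter \<open>\<tau>\<close>, on which \<open>g\<close> and \<open>w\<close> depend with
  derivatives \<open>g'\<close> and \<open>w'\<close>.\<close>
definition ysq_t :: "real \<Rightarrow> real \<Rightarrow> real \<Rightarrow> real \<Rightarrow> real \<Rightarrow> real" where
  "ysq_t g w g' w' a = g' * (g * (1 + ufun 0 w a) + 2 * ufun 1 w a)
     + w' * (g\<^sup>2 * ufun_w 0 w a / 2 + 2 * g * ufun_w 1 w a + 2 * ufun_w 2 w a)"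

definition ydy_t :: "real \<Rightarrow> real \<Rightarrow> real \<Rightarrow> real \<Rightarrow> real \<Rightarrow> real" where
  "ydy_t g w g' w' a = g' * (ufun 0 w a - g * w * ufun 1 w a / 2)
     + w' * (g * ufun_w 0 w a + ufun_w 1 w a - g\<^sup>2 * ufun 1 w a / 4 - g\<^sup>2 * w * ufun_w 1 w a / 4)"

definition yint_t :: "real \<Rightarrow> real \<Rightarrow> real \<Rightarrow> real \<Rightarrow> real \<Rightarrow> real" where
  "yint_t g w g' w' a = g' * (g * (a + ufun 1 w a) + 2 * ufun 2 w a)
     + w' * (g\<^sup>2 * ufun_w 1 w a / 2 + 2 * g * ufun_w 2 w a + 2 * ufun_w 3 w a)"

lemma ydy_square_poly:
  fixes g :: real
  assumes a: "w * C = 1 - A" and b: "B\<^sup>2 = 2 * C - w * C\<^sup>2"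
  shows "(g * A + B - g\<^sup>2 * w * B / 4)\<^sup>2 = (g\<^sup>2 * (1 + A) / 2 + 2 * g * B + 2 * C) * (1 + w * g\<^sup>2 / 4)
      - w * (g\<^sup>2 * (1 + A) / 2 + 2 * g * B + 2 * C)\<^sup>2 / 4"
proof -
  have A: "A = 1 - w * C" using a by simp
  have "(g * A + B - g\<^sup>2 * w * B / 4)\<^sup>2 - ((g\<^sup>2 * (1 + A) / 2 + 2 * g * B + 2 * C) * (1 + w * g\<^sup>2 / 4)
      - w * (g\<^sup>2 * (1 + A) / 2 + 2 * g * B + 2 * C)\<^sup>2 / 4) = (B\<^sup>2 - (2 * C - w * C\<^sup>2)) * (1 + w * g\<^sup>2 / 4)\<^sup>2"
    unfolding A by (simp add: field_simps power2_eq_square)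
  then show ?thesis using b by simp
qed

text \<open>Conservation of energy, multiplied by \<open>y\<^sup>2\<close>.\<close>
lemma ydy_square: "(ydy g w a)\<^sup>2 = ysq g w a * energy g w - w * (ysq g w a)\<^sup>2 / 4"
  unfolding ysq_def ydy_def energy_def by (rule ydy_square_poly[OF ufun_rec_numeral(1) ufun1_square])

lemma ufun_w_rec: "w * ufun_w (k + 2) w a = - ufun_w k w a - ufun (k + 2) w a"
proof -
  have r: "w * ufun (k + 4) w a = a ^ (k + 2) / fact (k + 2) - ufun (k + 2) w a"
    "w * ufun (k + 3) w a = a ^ (k + 1) / fact (k + 1) - ufun (k + 1) w a"
    using ufun_rec[of w "k + 2" a] ufun_rec[of w "k + 1" a] by (simp_all add: eval_nat_numeral)
  have f: "real (k + 2) * (a ^ (k + 2) / fact (k + 2)) = a * (a ^ (k + 1) / fact (k + 1))"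
    by (simp add: divide_simps)
  have "2 * (w * ufun_w (k + 2) w a) = real (k + 2) * (w * ufun (k + 4) w a) - a * (w * ufun (k + 3) w a)"
    by (simp add: ufun_w_def field_simps eval_nat_numeral)
  also have "\<dots> = a * ufun (k + 1) w a - real (k + 2) * ufun (k + 2) w a"
    unfolding r right_diff_distrib f by simp
  also have "\<dots> = 2 * (- ufun_w k w a - ufun (k + 2) w a)"
    by (simp add: ufun_w_def field_simps eval_nat_numeral)
  finally show ?thesis by simp
qed

text \<open>The derivative in \<open>\<tau>\<close> of the relation
  \<open>w * yint g w a / 2 = energy g w * a - ydy g w a + g\<close>, the integrated form of
  \<open>(y y')' = y'\<^sup>2 - (w / 4) y\<^sup>2\<close>.\<close>
lemma yint_energy_t:
  "w * yint_t g w g' w' a / 2 + w' * yint g w a / 2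
     = (w' * g\<^sup>2 + 2 * w * g * g') / 4 * a - ydy_t g w g' w' a + g'"
proof -
  have e: "ufun_w 0 w a = - (w * ufun_w 2 w a) - ufun 2 w a" "ufun_w 1 w a = - (w * ufun_w 3 w a) - ufun 3 w a"
    "ufun 0 w a = 1 - w * ufun 2 w a"
    using ufun_w_rec[of w 0 a] ufun_w_rec[of w 1 a] ufun_rec_numeral(1)[of w a]
    by (simp_all flip: numeral_2_eq_2 numeral_3_eq_3)
  show ?thesis
    unfolding yint_def ydy_t_def yint_t_def e by (simp add: field_simps power2_eq_square)
qed

text \<open>For \<open>v\<close> the derivative of \<open>y\<close> in \<open>\<tau>\<close>, the Wronskian \<open>y v' - y' v\<close> has the derivative
  \<open>- (w' / 4) y\<^sup>2\<close> in \<open>a\<close> and the value \<open>- g'\<close> at 0. The identity is this fact in terms of \<open>y\<^sup>2\<close>.\<close>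
lemma wronskian: "ydy g w a * ysq_t g w g' w' a - ysq g w a * ydy_t g w g' w' a
    = ysq g w a * (g' + w' * yint g w a / 4)"
proof -
  have D: "ufun_w 0 w a = - a * ufun 1 w a / 2" "ufun_w 1 w a = (ufun 3 w a - a * ufun 2 w a) / 2"
    "ufun_w 2 w a = (2 * ufun 4 w a - a * ufun 3 w a) / 2"
    by (simp_all add: ufun_w_def eval_nat_numeral)
  note g = wronskian_amp_coeff[OF ufun_rec_numeral(1) ufun1_square, of g w a]
  note w = wronskian_freq_coeff[OF ufun_rec_numeral(1) ufun1_square ufun_rec_numeral(2,3) ufun2_square D, of g]
  have "ydy g w a * ysq_t g w g' w' a - ysq g w a * ydy_t g w g' w' a =
    g' * (ydy g w a * (g * (1 + ufun 0 w a) + 2 * ufun 1 w a) - ysq g w a * (ufun 0 w a - g * w * ufun 1 w a / 2))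
    + w' * (ydy g w a * (g\<^sup>2 * ufun_w 0 w a / 2 + 2 * g * ufun_w 1 w a + 2 * ufun_w 2 w a) -
       ysq g w a * (g * ufun_w 0 w a + ufun_w 1 w a - g\<^sup>2 * ufun 1 w a / 4 - g\<^sup>2 * w * ufun_w 1 w a / 4))"
    by (simp add: ysq_t_def ydy_t_def algebra_simps)
  also have "\<dots> = ysq g w a * (g' + w' * yint g w a / 4)"
    unfolding ysq_def ydy_def yint_def g w by (simp add: field_simps)
  finally show ?thesis .
qed

section \<open>The characteristic equations\<close>

text \<open>The derivative of the value along a characteristic is \<open>F_x dx + F_t dt\<close>; here the energy is used.\<close>
lemma contact_along:
  assumes "ysq g w a \<noteq> 0"
  shows "ysq g w a + a * ydy g w a - 2 * a\<^sup>2 * energy g w + w * a\<^sup>2 * ysq g w a / 4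
    = (1 - a * ydy g w a / ysq g w a) * (ysq g w a + 2 * a * ydy g w a)
       + w * a\<^sup>2 / 8 * (- 2 * ysq g w a)"
  using ydy_square[of g w a] assms by (simp add: field_simps) algebra

text \<open>The same in the direction \<open>\<tau>\<close> transversal to the characteristics. The coupling \<open>w = 12 g'\<close> is
  exactly what this direction requires.\<close>
lemma contact_across:
  assumes "ysq g w a \<noteq> 0" "w = 12 * g'"
  shows "a * ysq_t g w g' w' a - a\<^sup>2 * ydy_t g w g' w' a / 2
      - a ^ 3 * ((w' * g\<^sup>2 + 2 * w * g * g') / 4) / 2
    = (1 - a * ydy g w a / ysq g w a) * (a * ysq_t g w g' w' a)
       + w * a\<^sup>2 / 8 * (1 - 2 * yint_t g w g' w' a)"
proof -
  let ?Q = "ysq g w a" and ?Qt = "ysq_t g w g' w' a"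
  have "ydy g w a * ?Qt = ?Q * (ydy_t g w g' w' a + g' + w' * yint g w a / 4)"
    using wronskian[of g w a g' w'] by (simp add: algebra_simps)
  then have "ydy g w a / ?Q * ?Qt = ydy_t g w g' w' a + g' + w' * yint g w a / 4"
    using assms(1) by (simp add: field_simps)
  moreover have "(1 - a * ydy g w a / ?Q) * (a * ?Qt) = a * ?Qt - a\<^sup>2 * (ydy g w a / ?Q * ?Qt)"
    by (simp add: algebra_simps power2_eq_square)
  ultimately have slope: "(1 - a * ydy g w a / ?Q) * (a * ?Qt)
      = a * ?Qt - a\<^sup>2 * (ydy_t g w g' w' a + g' + w' * yint g w a / 4)"
    by simp
  have mult_w: "w * a\<^sup>2 / 8 * (1 - 2 * yint_t g w g' w' a) = w * a\<^sup>2 / 8 - a\<^sup>2 / 2 * (w * yint_t g w g' w' a / 2)"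
    by (simp add: field_simps)
  have "w * yint_t g w g' w' a / 2 = (w' * g\<^sup>2 + 2 * w * g * g') / 4 * a - ydy_t g w g' w' a + g'
      - w' * yint g w a / 2"
    using yint_energy_t[of w g g' w' a] by linarith
  then have mid: "w * a\<^sup>2 / 8 * (1 - 2 * yint_t g w g' w' a)
      = w * a\<^sup>2 / 8 - a\<^sup>2 / 2 * ((w' * g\<^sup>2 + 2 * w * g * g') / 4 * a - ydy_t g w g' w' a + g'
      - w' * yint g w a / 2)"
    unfolding mult_w by simp
  show ?thesis
    unfolding slope mid using assms(2) by (simp add: field_simps power2_eq_square power3_eq_cube)
qed

lemma uval_solves_equation:
  assumes "ysq g w a \<noteq> 0" "a \<noteq> 0"
  shows "w * a\<^sup>2 / 8 + 1/2 * ((1 - a * ydy g w a / ysq g w a) - 1) * ((1 - a * ydy g w a / ysq g w a) - 2)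
    + uval g w a / (a * ysq g w a) - 1 = 0"
  using ydy_square[of g w a] assms unfolding uval_def by (simp add: field_simps) algebra

context
  fixes g w :: "real \<Rightarrow> real" and g' w' :: real and z :: "real \<times> real"
  assumes g: "(g has_field_derivative g') (at (snd z))"
    and w: "(w has_field_derivative w') (at (snd z))"
begin

lemma lift_has_derivative:
  "((\<lambda>z. g (snd z)) has_derivative (\<lambda>h. g' * snd h)) (at z)"
  "((\<lambda>z. w (snd z)) has_derivative (\<lambda>h. w' * snd h)) (at z)"
  using has_derivative_compose[OF has_derivative_snd[OF has_derivative_ident] g[unfolded has_field_derivative_def]]
  has_derivative_compose[OF has_derivative_snd[OF has_derivative_ident] w[unfolded has_field_derivative_def]]
  by simp_all

lemma ufun_derivs:
  "((\<lambda>z. ufun 0 (w (snd z)) (fst z)) has_derivative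
     (\<lambda>h. - w (snd z) * ufun 1 (w (snd z)) (fst z) * fst h + w' * ufun_w 0 (w (snd z)) (fst z) * snd h)) (at z)"
  "((\<lambda>z. ufun 1 (w (snd z)) (fst z)) has_derivative
     (\<lambda>h. ufun 0 (w (snd z)) (fst z) * fst h + w' * ufun_w 1 (w (snd z)) (fst z) * snd h)) (at z)"
  "((\<lambda>z. ufun 2 (w (snd z)) (fst z)) has_derivative
     (\<lambda>h. ufun 1 (w (snd z)) (fst z) * fst h + w' * ufun_w 2 (w (snd z)) (fst z) * snd h)) (at z)"
  "((\<lambda>z. ufun 3 (w (snd z)) (fst z)) has_derivative
     (\<lambda>h. ufun 2 (w (snd z)) (fst z) * fst h + w' * ufun_w 3 (w (snd z)) (fst z) * snd h)) (at z)"
  using ufun_has_derivative(2)[OF w] ufun_has_derivative(1)[OF w, of 0] ufun_has_derivative(1)[OF w, of 1]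
     ufun_has_derivative(1)[OF w, of 2]
  by (simp_all flip: numeral_2_eq_2 numeral_3_eq_3)

lemma ysq_has_derivative:
  "((\<lambda>z. ysq (g (snd z)) (w (snd z)) (fst z)) has_derivative
     (\<lambda>h. 2 * ydy (g (snd z)) (w (snd z)) (fst z) * fst h
       + ysq_t (g (snd z)) (w (snd z)) g' w' (fst z) * snd h)) (at z)"
  unfolding ysq_def
  by (rule has_derivative_eq_rhs, (rule derivative_intros lift_has_derivative ufun_derivs | simp)+)
    (simp add: fun_eq_iff ydy_def ysq_t_def field_simps power2_eq_square)

lemma ydy_has_derivative:
  "((\<lambda>z. ydy (g (snd z)) (w (snd z)) (fst z)) has_derivative
     (\<lambda>h. (energy (g (snd z)) (w (snd z)) - w (snd z) * ysq (g (snd z)) (w (snd z)) (fst z) / 2) * fst h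
       + ydy_t (g (snd z)) (w (snd z)) g' w' (fst z) * snd h)) (at z)"
proof -
  have r: "ufun 0 (w (snd z)) (fst z) = 1 - w (snd z) * ufun 2 (w (snd z)) (fst z)"
    using ufun_rec_numeral(1)[of "w (snd z)" "fst z"] by simp
  show ?thesis
    unfolding ydy_def
    apply (rule has_derivative_eq_rhs, (rule derivative_intros lift_has_derivative ufun_derivs | simp)+)
    apply (simp add: fun_eq_iff ydy_t_def energy_def ysq_def r)
    apply (simp add: field_simps power2_eq_square)
    done
qed

lemma yint_has_derivative:
  "((\<lambda>z. yint (g (snd z)) (w (snd z)) (fst z)) has_derivative
     (\<lambda>h. ysq (g (snd z)) (w (snd z)) (fst z) * fst h
       + yint_t (g (snd z)) (w (snd z)) g' w' (fst z) * snd h)) (at z)"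
  unfolding yint_def
  by (rule has_derivative_eq_rhs, (rule derivative_intros lift_has_derivative ufun_derivs | simp)+)
    (simp add: fun_eq_iff ysq_def yint_t_def field_simps power2_eq_square)

lemma energy_has_derivative:
  "((\<lambda>z. energy (g (snd z)) (w (snd z))) has_derivative
     (\<lambda>h. (w' * (g (snd z))\<^sup>2 + 2 * w (snd z) * g (snd z) * g') / 4 * snd h)) (at z)"
  unfolding energy_def
  by (rule has_derivative_eq_rhs, (rule derivative_intros lift_has_derivative | simp)+)
    (simp add: fun_eq_iff field_simps power2_eq_square)

text \<open>The two contact identities combined: the differential of the value is slope times the differential
  of \<open>x\<close> plus rate times the differential of \<open>t\<close>, for \<open>x = a ysq\<close> and \<open>t = \<tau> - 2 yint\<close>.\<close>
lemma uval_has_derivative: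
  assumes "w (snd z) = 12 * g'" "ysq (g (snd z)) (w (snd z)) (fst z) \<noteq> 0"
  shows "((\<lambda>z. uval (g (snd z)) (w (snd z)) (fst z)) has_derivative
     (\<lambda>h. (1 - fst z * ydy (g (snd z)) (w (snd z)) (fst z) / ysq (g (snd z)) (w (snd z)) (fst z))
        * ((ysq (g (snd z)) (w (snd z)) (fst z) + 2 * fst z * ydy (g (snd z)) (w (snd z)) (fst z)) * fst h
           + fst z * ysq_t (g (snd z)) (w (snd z)) g' w' (fst z) * snd h)
      + w (snd z) * (fst z)\<^sup>2 / 8 * (- 2 * ysq (g (snd z)) (w (snd z)) (fst z) * fst h
          + (1 - 2 * yint_t (g (snd z)) (w (snd z)) g' w' (fst z)) * snd h))) (at z)"
proof -
  let ?g = "g (snd z)" and ?w = "w (snd z)" and ?a = "fst z"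
  have "((\<lambda>z. uval (g (snd z)) (w (snd z)) (fst z)) has_derivative
     (\<lambda>h. (ysq ?g ?w ?a + ?a * ydy ?g ?w ?a - 2 * ?a\<^sup>2 * energy ?g ?w + ?w * ?a\<^sup>2 * ysq ?g ?w ?a / 4) * fst h
       + (?a * ysq_t ?g ?w g' w' ?a - ?a\<^sup>2 * ydy_t ?g ?w g' w' ?a / 2
      - ?a ^ 3 * ((w' * ?g\<^sup>2 + 2 * ?w * ?g * g') / 4) / 2) * snd h)) (at z)"
    unfolding uval_def
    by (rule has_derivative_eq_rhs, (rule derivative_intros ysq_has_derivative ydy_has_derivative energy_has_derivative | simp)+)
    (simp add: fun_eq_iff field_simps power2_eq_square power3_eq_cube)
  then show ?thesis
    unfolding contact_along[OF assms(2)] contact_across[OF assms(2,1)]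
    by (rule has_derivative_eq_rhs) (simp add: fun_eq_iff algebra_simps)
qed

end

section \<open>Estimates near the stationary family\<close>

lemma abs_mult_le: "\<bar>x\<bar> \<le> B \<Longrightarrow> \<bar>c\<bar> \<le> C \<Longrightarrow> \<bar>c * x\<bar> \<le> C * B" for x :: real
  unfolding abs_mult by (intro mult_mono) auto

text \<open>The amplitude of the oscillation of \<open>g\<close>; its small size makes the non-stationary terms
  negligible against all constants below.\<close>
definition slow :: real where "slow = 1 / 10 ^ 6"

text \<open>The part of a characteristic with time above 1 satisfies \<open>a ^ 3 \<le> 8 * \<tau>\<close> (see \<open>char_time_boundary\<close>). Together with
  \<open>w = O(1 / \<tau>)\<close> this bounds \<open>w a ^ 3\<close>, so that a term with the factor \<open>w a ^ 4\<close> is of order \<open>a\<close> and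
  therefore small compared with \<open>(1 + a)\<^sup>2\<close>.\<close>
locale char_domain =
  fixes a \<tau> g w g' w' :: real
  assumes a0: "0 \<le> a" and \<tau>1: "1 \<le> \<tau>" and cube: "a ^ 3 \<le> 8 * \<tau>"
    and g: "1 \<le> g" "g \<le> 3" and w: "\<bar>w\<bar> \<le> 12 * slow / \<tau>"
begin

lemma a_le: "a \<le> 2 * \<tau>"
proof (rule ccontr)
  assume "\<not> ?thesis"
  then have "(2 * \<tau>) ^ 3 < a ^ 3" using \<tau>1 by (intro power_strict_mono) auto
  moreover have "\<tau> * 1 \<le> \<tau> * (\<tau> * \<tau>)" using \<tau>1 by (intro mult_left_mono) (auto simp: mult_ge1_I)
  ultimately show False using cube by (simp add: power3_eq_cube)
qed

lemma a2_le: "a\<^sup>2 \<le> 4 * \<tau>"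
proof (cases "a \<le> 2")
  case True
  then have "a\<^sup>2 \<le> 2\<^sup>2" using a0 by (intro power_mono)
  then show ?thesis using \<tau>1 by simp
next
  case False
  then have "2 * a\<^sup>2 \<le> a * a\<^sup>2" by (intro mult_right_mono) auto
  then show ?thesis using cube by (simp add: power3_eq_cube power2_eq_square)
qed

lemma slow_pos: "slow > 0" by (simp add: slow_def)

lemma freq_scaled_le:
  assumes "x \<le> C * \<tau>" "0 \<le> x"
  shows "\<bar>w\<bar> * x \<le> 12 * slow * C"
proof -
  have "\<bar>w\<bar> * x \<le> (12 * slow / \<tau>) * (C * \<tau>)" using assms w by (intro mult_mono) auto
  also have "\<dots> = 12 * slow * C" using \<tau>1 by simp
  finally show ?thesis .
qed

lemma freq_power_le: "\<bar>w\<bar> * a \<le> 24 * slow" "\<bar>w\<bar> * a\<^sup>2 \<le> 48 * slow" "\<bar>w\<bar> * a ^ 3 \<le> 96 * slow"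
    "\<bar>w\<bar> * a ^ 4 \<le> 96 * slow * a" "\<bar>w\<bar> \<le> 12 * slow"
proof -
  show "\<bar>w\<bar> * a \<le> 24 * slow" "\<bar>w\<bar> * a\<^sup>2 \<le> 48 * slow" and 3: "\<bar>w\<bar> * a ^ 3 \<le> 96 * slow"
    using freq_scaled_le[OF a_le] freq_scaled_le[OF a2_le] freq_scaled_le[OF cube] a0 by auto
  show "\<bar>w\<bar> \<le> 12 * slow" using freq_scaled_le[of 1 1] \<tau>1 by simp
  have "\<bar>w\<bar> * a ^ 3 * a \<le> 96 * slow * a"
    using 3 a0 by (intro mult_right_mono)
  then show "\<bar>w\<bar> * a ^ 4 \<le> 96 * slow * a"
    by (simp add: eval_nat_numeral mult_ac)
qed

lemma ufun_le: "\<bar>ufun k w a\<bar> \<le> 3 * a ^ k"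
  by (rule abs_ufun_le[OF _ a0]) (use freq_power_le(2) in \<open>simp add: abs_mult slow_def\<close>)

lemma w_ufun_le: "\<bar>w * ufun k w a\<bar> \<le> 3 * (\<bar>w\<bar> * a ^ k)"
  using mult_left_mono[OF ufun_le, of "\<bar>w\<bar>" k] by (simp add: abs_mult mult_ac)

lemma w_ufun: "\<bar>w * ufun 1 w a\<bar> \<le> 72 * slow" "\<bar>w * ufun 2 w a\<bar> \<le> 144 * slow" "\<bar>w * ufun 3 w a\<bar> \<le> 288 * slow"
   "\<bar>w * ufun 4 w a\<bar> \<le> 288 * slow * a"
proof -
  show "\<bar>w * ufun 1 w a\<bar> \<le> 72 * slow" using w_ufun_le[of 1] freq_power_le(1) by simp
  show "\<bar>w * ufun 2 w a\<bar> \<le> 144 * slow" using w_ufun_le[of 2] freq_power_le(2) by linarith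
  show "\<bar>w * ufun 3 w a\<bar> \<le> 288 * slow" using w_ufun_le[of 3] freq_power_le(3) by linarith
  show "\<bar>w * ufun 4 w a\<bar> \<le> 288 * slow * a" using w_ufun_le[of 4] freq_power_le(4) by linarith
qed

lemma g_sq: "\<bar>g\<bar> \<le> 3" "\<bar>g\<^sup>2\<bar> \<le> 9" "1 \<le> g\<^sup>2" "g \<le> g\<^sup>2"
proof -
  show "\<bar>g\<bar> \<le> 3" using g by simp
  then show "\<bar>g\<^sup>2\<bar> \<le> 9" using power_mono[of "\<bar>g\<bar>" 3 2] by simp
  show "g \<le> g\<^sup>2" using g mult_right_mono[of 1 g g] by (simp add: power2_eq_square)
  then show "1 \<le> g\<^sup>2" using g by simp
qed

text \<open>In the stationary case \<open>w = 0\<close> the oscillator is \<open>y = g + a\<close>. The recursion of the universal functions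
  isolates the deviation as terms with an explicit factor \<open>w\<close>.\<close>
lemma ysq_expand: "ysq g w a = (g + a)\<^sup>2 - (g\<^sup>2 * (w * ufun 2 w a) / 2 + 2 * (g * (w * ufun 3 w a)) + 2 * (w * ufun 4 w a))"
  unfolding ysq_def ufun_rec_numeral by (simp add: field_simps power2_eq_square)

lemma ydy_expand: "ydy g w a = g + a - (g * (w * ufun 2 w a) + w * ufun 3 w a + g\<^sup>2 * (w * ufun 1 w a) / 4)"
  unfolding ydy_def ufun_rec_numeral by (simp add: field_simps power2_eq_square)

lemma yint_expand: "yint g w a = g\<^sup>2 * a + g * a\<^sup>2 + a ^ 3 / 3
   - (g\<^sup>2 * (w * ufun 3 w a) / 2 + 2 * (g * (w * ufun 4 w a)) + 2 * (w * ufun 5 w a))"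
  unfolding yint_def ufun_rec_numeral by (simp add: field_simps power2_eq_square)

lemma ysq_err: "\<bar>ysq g w a - (g + a)\<^sup>2\<bar> \<le> 3000 * slow * (1 + a)"
  using abs_mult_le[OF w_ufun(2) g_sq(2)] abs_mult_le[OF w_ufun(3) g_sq(1)] w_ufun(4) slow_pos
     mult_nonneg_nonneg[OF less_imp_le[OF slow_pos] a0]
  unfolding ysq_expand by (simp add: abs_le_iff algebra_simps)

lemma ydy_err: "\<bar>ydy g w a - (g + a)\<bar> \<le> 1000 * slow"
  using abs_mult_le[OF w_ufun(2) g_sq(1)] abs_mult_le[OF w_ufun(1) g_sq(2)] w_ufun(3) slow_pos
  unfolding ydy_expand by (simp add: abs_le_iff algebra_simps)

lemma yint_err: "\<bar>yint g w a - (g\<^sup>2 * a + g * a\<^sup>2 + a ^ 3 / 3)\<bar> \<le> 3000 * slow * (a + a\<^sup>2 + a ^ 3)"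
proof -
  have b: "\<bar>w\<bar> * a ^ 3 \<le> 48 * slow * a" "\<bar>w\<bar> * a ^ 4 \<le> 48 * slow * a\<^sup>2" "\<bar>w\<bar> * a ^ 5 \<le> 48 * slow * a ^ 3"
    using mult_right_mono[OF freq_power_le(2), of a] mult_right_mono[OF freq_power_le(2), of "a\<^sup>2"] mult_right_mono[OF freq_power_le(2), of "a ^ 3"] a0
    by (simp_all add: eval_nat_numeral mult_ac)
  have w_ufun_tail: "\<bar>w * ufun 3 w a\<bar> \<le> 144 * slow * a" "\<bar>w * ufun 4 w a\<bar> \<le> 144 * slow * a\<^sup>2" "\<bar>w * ufun 5 w a\<bar> \<le> 144 * slow * a ^ 3"
    using order_trans[OF w_ufun_le[of 3]] order_trans[OF w_ufun_le[of 4]] order_trans[OF w_ufun_le[of 5]] b by simp_all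
  show ?thesis
  using abs_mult_le[OF w_ufun_tail(1) g_sq(2)] abs_mult_le[OF w_ufun_tail(2) g_sq(1)] w_ufun_tail(3) slow_pos
     mult_nonneg_nonneg[OF less_imp_le[OF slow_pos] a0]
     mult_nonneg_nonneg[OF less_imp_le[OF slow_pos] zero_le_power2[of a]]
     mult_nonneg_nonneg[OF less_imp_le[OF slow_pos] zero_le_power[OF a0, of 3]]
  unfolding yint_expand by (simp add: abs_le_iff algebra_simps)
qed

lemma ysq_lower: "(1 + a)\<^sup>2 / 2 \<le> ysq g w a" and ysq_upper: "ysq g w a \<le> 20 * (1 + a)\<^sup>2"
proof -
  have 1: "3000 * slow * (1 + a) \<le> (1 + a)\<^sup>2 / 2"
  proof -
    have "3000 * slow * (1 + a) \<le> (1 + a) / 2 * (1 + a)"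
      using a0 by (intro mult_right_mono) (auto simp: slow_def)
    then show ?thesis by (simp add: power2_eq_square)
  qed
  have "(1 + a)\<^sup>2 \<le> (g + a)\<^sup>2" "(g + a)\<^sup>2 \<le> (3 * (1 + a))\<^sup>2"
    using g a0 by (auto intro!: power_mono)
  then show "(1 + a)\<^sup>2 / 2 \<le> ysq g w a" "ysq g w a \<le> 20 * (1 + a)\<^sup>2"
    using ysq_err 1 unfolding power_mult_distrib by (auto simp: abs_le_iff)
qed

lemma ysq_pos: "ysq g w a > 0"
  by (rule less_le_trans[OF _ ysq_lower]) (use a0 in auto)

lemma ydy_pos: "ydy g w a > 0"
proof -
  have "1000 * slow = 1 / 1000" by (simp add: slow_def)
  then show ?thesis using ydy_err g a0 by linarith
qed

text \<open>The slope \<open>1 - a y' / y\<close> vanishes to leading order as \<open>a\<close> grows, since \<open>y\<^sup>2 - a y y'\<close> is about \<open>g (g + a)\<close>;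
  the error \<open>O(slow * (1 + a))\<close> of \<open>ysq_err\<close> is just good enough.\<close>
lemma slope_nonneg: "a * ydy g w a \<le> ysq g w a"
proof -
  define X Y where "X = a * (g + a)" and "Y = g * (g + a)"
  have "a * ydy g w a \<le> a * (g + a + 1000 * slow)"
    using ydy_err a0 by (intro mult_left_mono) (auto simp: abs_le_iff)
  also have "\<dots> = X + a / 1000" by (simp add: X_def slow_def algebra_simps)
  finally have 1: "a * ydy g w a \<le> X + a / 1000" .
  have "(g + a)\<^sup>2 = X + Y" by (simp add: X_def Y_def power2_eq_square algebra_simps)
  moreover have "3000 * slow * (1 + a) = 3 / 1000 + 3 / 1000 * a" by (simp add: slow_def algebra_simps)
  ultimately have 2: "X + Y - (3 / 1000 + 3 / 1000 * a) \<le> ysq g w a"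
    using abs_le_D2[OF ysq_err] by linarith
  have "1 * (1 + a) \<le> Y" unfolding Y_def using g a0 by (intro mult_mono) auto
  then show ?thesis using 1 2 a0 by argo
qed

lemma energy_nonneg: "0 \<le> energy g w"
  using abs_mult_le[OF freq_power_le(5) g_sq(2)] unfolding energy_def slow_def by (simp add: abs_le_iff mult.commute)

lemma yint_lower: "a ^ 3 / 6 \<le> yint g w a" and yint_upper: "yint g w a \<le> 10 * (a + a\<^sup>2 + a ^ 3)"
proof -
  define X Y where "X = g\<^sup>2 * a" and "Y = g * a\<^sup>2"
  have XY: "1 * a \<le> X" "1 * a\<^sup>2 \<le> Y" "X \<le> 9 * a" "Y \<le> 3 * a\<^sup>2"
    unfolding X_def Y_def using g g_sq a0 by (intro mult_right_mono; simp)+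
  have p: "0 \<le> a\<^sup>2" "0 \<le> a ^ 3" using a0 by auto
  have "3000 * slow * (a + a\<^sup>2 + a ^ 3) = 3 / 1000 * a + 3 / 1000 * a\<^sup>2 + 3 / 1000 * a ^ 3"
    by (simp add: slow_def algebra_simps)
  then have B: "yint g w a \<le> X + Y + a ^ 3 / 3 + (3 / 1000 * a + 3 / 1000 * a\<^sup>2 + 3 / 1000 * a ^ 3)"
    "X + Y + a ^ 3 / 3 - (3 / 1000 * a + 3 / 1000 * a\<^sup>2 + 3 / 1000 * a ^ 3) \<le> yint g w a"
    using abs_le_D1[OF yint_err] abs_le_D2[OF yint_err] unfolding X_def Y_def by linarith+
  show "a ^ 3 / 6 \<le> yint g w a" using B XY p a0 by argo
  show "yint g w a \<le> 10 * (a + a\<^sup>2 + a ^ 3)" using B XY p a0 by argo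
qed

lemma uval_le: "uval g w a \<le> a * ysq g w a"
proof -
  have "0 \<le> a\<^sup>2 * ydy g w a" "0 \<le> a ^ 3 * energy g w"
    using ydy_pos energy_nonneg a0 by simp_all
  then show ?thesis unfolding uval_def by linarith
qed

text \<open>The part of the value beyond the stationary expression \<open>a g\<^sup>2 + 3 g a\<^sup>2 / 2\<close>.\<close>
definition "expansion_rest = g\<^sup>2 * (- (w * ufun 2 w a) + a * (w * ufun 1 w a) / 4 - w * a\<^sup>2 / 4)
      + g * (- 4 * (w * ufun 3 w a) + a * (w * ufun 2 w a)) + (a * (w * ufun 3 w a) - 4 * (w * ufun 4 w a))"

lemma uval_expand: "uval g w a = a / 2 * (2 * g\<^sup>2 + 3 * g * a + expansion_rest)"
  unfolding uval_def ysq_expand ydy_expand energy_def expansion_rest_def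
  by (simp add: field_simps power2_eq_square power3_eq_cube)

text \<open>The bound does not grow with \<open>a\<close>, although single terms are of size \<open>w a ^ 4\<close>: the leading terms of
  \<open>a * ufun 3\<close> and \<open>4 * ufun 4\<close> are both \<open>a ^ 4 / 6\<close>, so their difference is of second order in \<open>w\<close>.
  This cancellation is what makes \<open>3 g / 2\<close> the exact ratio to \<open>x powr (2/3)\<close> far out.\<close>
lemma expansion_rest_le: "\<bar>expansion_rest\<bar> \<le> 10000 * slow"
proof -
  have aw: "\<bar>a * (w * ufun 1 w a)\<bar> \<le> 144 * slow" "\<bar>a * (w * ufun 2 w a)\<bar> \<le> 288 * slow"
    using mult_left_mono[OF w_ufun_le[of 1], of a] mult_left_mono[OF w_ufun_le[of 2], of a] a0 freq_power_le(2,3)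
    by (simp_all add: abs_mult power2_eq_square power3_eq_cube mult_ac)
  have "\<bar>a * (w * ufun 3 w a) - 4 * (w * ufun 4 w a)\<bar> \<le> 10 * slow"
  proof -
    have "a * (w * ufun 3 w a) - 4 * (w * ufun 4 w a) = w * (w * (4 * ufun 6 w a - a * ufun 5 w a))"
      using ufun_rec_numeral(4,5)[of w a] by algebra
    moreover have "\<bar>4 * ufun 6 w a - a * ufun 5 w a\<bar> \<le> 15 * a ^ 6"
    proof -
      have "\<bar>a * ufun 5 w a\<bar> \<le> a * (3 * a ^ 5)" using a0 by (intro abs_mult_le ufun_le) simp
      also have "\<dots> = 3 * a ^ 6" by (simp add: eval_nat_numeral)
      finally show ?thesis using ufun_le[of 6] by linarith
    qed
    then have "\<bar>w\<bar> * (\<bar>w\<bar> * \<bar>4 * ufun 6 w a - a * ufun 5 w a\<bar>) \<le> \<bar>w\<bar> * (\<bar>w\<bar> * (15 * a ^ 6))"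
      by (intro mult_left_mono) auto
    moreover have "(\<bar>w\<bar> * a ^ 3) * (\<bar>w\<bar> * a ^ 3) \<le> (96 * slow) * (96 * slow)"
      by (rule mult_mono) (use freq_power_le(3) a0 slow_pos in simp_all)
    moreover have "(96 * slow) * (96 * slow) * 15 \<le> 10 * slow" by (simp add: slow_def)
    ultimately show ?thesis by (simp add: abs_mult eval_nat_numeral mult_ac)
  qed
  moreover have "\<bar>g\<^sup>2 * (- (w * ufun 2 w a) + a * (w * ufun 1 w a) / 4 - w * a\<^sup>2 / 4)\<bar> \<le> 9 * (192 * slow)"
  proof (rule abs_mult_le[OF _ g_sq(2)])
    have "\<bar>w * a\<^sup>2\<bar> \<le> 48 * slow" using freq_power_le(2) by (simp add: abs_mult)
    then show "\<bar>- (w * ufun 2 w a) + a * (w * ufun 1 w a) / 4 - w * a\<^sup>2 / 4\<bar> \<le> 192 * slow"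
      using w_ufun(2) aw(1) by (simp add: abs_le_iff)
  qed
  moreover have "\<bar>g * (- 4 * (w * ufun 3 w a) + a * (w * ufun 2 w a))\<bar> \<le> 3 * (1440 * slow)"
    by (rule abs_mult_le[OF _ g_sq(1)]) (use w_ufun(3) aw(2) in \<open>simp add: abs_le_iff\<close>)
  ultimately show ?thesis unfolding expansion_rest_def using slow_pos by (simp add: abs_le_iff)
qed

lemma uval_nonneg: "0 \<le> uval g w a"
proof -
  have "0 \<le> g * a" "1 \<le> g\<^sup>2" using g a0 g_sq by auto
  then show ?thesis unfolding uval_expand using expansion_rest_le a0 unfolding slow_def
    by (intro mult_nonneg_nonneg) (auto simp: abs_le_iff)
qed

lemma uval_upper: "uval g w a \<le> 15 * a * (1 + a)"
proof -
  have "g * a \<le> 3 * a" "g\<^sup>2 \<le> 9" using g a0 g_sq by (auto intro: mult_right_mono)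
  then have "2 * g\<^sup>2 + 3 * g * a + expansion_rest \<le> 30 * (1 + a)"
    using expansion_rest_le a0 unfolding slow_def by (auto simp: abs_le_iff)
  then have "a / 2 * (2 * g\<^sup>2 + 3 * g * a + expansion_rest) \<le> a / 2 * (30 * (1 + a))" using a0 by (intro mult_left_mono) auto
  then show ?thesis unfolding uval_expand by (simp add: algebra_simps)
qed

end

text \<open>Bounds on the derivatives in \<open>\<tau>\<close>: since \<open>g'\<close> is \<open>O(1 / \<tau>)\<close> and \<open>w'\<close> is \<open>O(1 / \<tau>\<^sup>2)\<close>, moving from one
  characteristic to the next changes the time at a fixed \<open>a\<close> almost at unit rate and the place hardly.\<close>
locale char_domain_t = char_domain +
  assumes g': "\<bar>g'\<bar> \<le> slow / \<tau>" and w': "\<bar>w'\<bar> \<le> 24 * slow / \<tau>\<^sup>2"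
begin

lemma ufun_w_le: "\<bar>ufun_w k w a\<bar> \<le> 3 / 2 * (real k + 1) * a ^ (k + 2)"
proof -
  have "\<bar>real k * ufun (k + 2) w a\<bar> \<le> real k * (3 * a ^ (k + 2))" "\<bar>a * ufun (k + 1) w a\<bar> \<le> a * (3 * a ^ (k + 1))"
    using a0 by (intro abs_mult_le ufun_le; simp)+
  then show ?thesis unfolding ufun_w_def by (simp add: abs_le_iff algebra_simps)
qed

lemma w'_le:
  assumes "x \<le> C * \<tau>\<^sup>2" "0 \<le> x"
  shows "\<bar>w'\<bar> * x \<le> 24 * slow * C"
proof -
  have "\<bar>w'\<bar> * x \<le> (24 * slow / \<tau>\<^sup>2) * (C * \<tau>\<^sup>2)" using assms w' by (intro mult_mono) auto
  also have "\<dots> = 24 * slow * C" using \<tau>1 by simp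
  finally show ?thesis .
qed

lemma g'_le:
  assumes "x \<le> C * \<tau>" "0 \<le> x"
  shows "\<bar>g'\<bar> * x \<le> slow * C"
proof -
  have "\<bar>g'\<bar> * x \<le> (slow / \<tau>) * (C * \<tau>)" using assms g' by (intro mult_mono) auto
  also have "\<dots> = slow * C" using \<tau>1 by simp
  finally show ?thesis .
qed

lemma pow_le: "a ^ 3 \<le> 8 * \<tau>\<^sup>2" "a ^ 4 \<le> 16 * \<tau>\<^sup>2" "a ^ 5 \<le> 32 * \<tau>\<^sup>2"
proof -
  have \<tau>: "\<tau> \<le> \<tau>\<^sup>2" using \<tau>1 mult_right_mono[of 1 \<tau> \<tau>] by (simp add: power2_eq_square)
  then show "a ^ 3 \<le> 8 * \<tau>\<^sup>2" using cube by simp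
  have "a\<^sup>2 * a\<^sup>2 \<le> (4 * \<tau>) * (4 * \<tau>)" using a2_le a0 \<tau>1 by (intro mult_mono) auto
  then show "a ^ 4 \<le> 16 * \<tau>\<^sup>2" by (simp add: eval_nat_numeral mult_ac)
  have "a ^ 3 * a\<^sup>2 \<le> (8 * \<tau>) * (4 * \<tau>)" using a2_le cube a0 \<tau>1 by (intro mult_mono) auto
  then show "a ^ 5 \<le> 32 * \<tau>\<^sup>2" by (simp add: eval_nat_numeral mult_ac)
qed

lemma w'_ufun_w_le: "\<bar>w' * (c * ufun_w k w a)\<bar> \<le> \<bar>c\<bar> * (3 / 2 * (real k + 1)) * (\<bar>w'\<bar> * a ^ (k + 2))"
proof -
  have "\<bar>w'\<bar> * \<bar>c\<bar> * \<bar>ufun_w k w a\<bar> \<le> \<bar>w'\<bar> * \<bar>c\<bar> * (3 / 2 * (real k + 1) * a ^ (k + 2))"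
    using ufun_w_le by (intro mult_left_mono) auto
  then show ?thesis by (simp add: abs_mult mult_ac)
qed

lemma yint_t_le: "\<bar>yint_t g w g' w' a\<bar> \<le> 1 / 8"
proof -
  have A: "\<bar>g'\<bar> * a \<le> slow * 2" "\<bar>g'\<bar> * a\<^sup>2 \<le> slow * 4" using g'_le a_le a2_le a0 by auto
  have B: "\<bar>w'\<bar> * a ^ 3 \<le> 24 * slow * 8" "\<bar>w'\<bar> * a ^ 4 \<le> 24 * slow * 16" "\<bar>w'\<bar> * a ^ 5 \<le> 24 * slow * 32"
    using w'_le[OF pow_le(1)] w'_le[OF pow_le(2)] w'_le[OF pow_le(3)] a0 by auto
  have "\<bar>g * (a + ufun 1 w a) + 2 * ufun 2 w a\<bar> \<le> 12 * a + 6 * a\<^sup>2"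
  proof -
    have "\<bar>g * (a + ufun 1 w a)\<bar> \<le> 3 * (4 * a)"
      using ufun_le[of 1] a0 by (intro abs_mult_le g_sq) (auto simp: abs_le_iff)
    then show ?thesis using ufun_le[of 2] by (simp add: abs_le_iff)
  qed
  then have "\<bar>g'\<bar> * \<bar>g * (a + ufun 1 w a) + 2 * ufun 2 w a\<bar> \<le> \<bar>g'\<bar> * (12 * a + 6 * a\<^sup>2)" by (intro mult_left_mono) auto
  then have 1: "\<bar>g' * (g * (a + ufun 1 w a) + 2 * ufun 2 w a)\<bar> \<le> 48 * slow"
    using A unfolding abs_mult by (simp add: algebra_simps)
  have c: "\<bar>g\<^sup>2 / 2\<bar> \<le> 9 / 2" "\<bar>2 * g\<bar> \<le> 6" using g_sq by auto
  have 2: "\<bar>w' * (g\<^sup>2 / 2 * ufun_w 1 w a)\<bar> \<le> 9 / 2 * 3 * (24 * slow * 8)"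
    by (rule order_trans[OF w'_ufun_w_le mult_mono]) (use c B a0 in \<open>auto simp flip: numeral_3_eq_3\<close>)
  have 3: "\<bar>w' * (2 * g * ufun_w 2 w a)\<bar> \<le> 6 * (9 / 2) * (24 * slow * 16)"
    by (rule order_trans[OF w'_ufun_w_le mult_mono]) (use c B a0 in auto)
  have 4: "\<bar>w' * (2 * ufun_w 3 w a)\<bar> \<le> 2 * 6 * (24 * slow * 32)"
    by (rule order_trans[OF w'_ufun_w_le mult_mono]) (use B a0 in auto)
  have eq: "yint_t g w g' w' a = g' * (g * (a + ufun 1 w a) + 2 * ufun 2 w a)
     + w' * (g\<^sup>2 / 2 * ufun_w 1 w a) + w' * (2 * g * ufun_w 2 w a) + w' * (2 * ufun_w 3 w a)"
    unfolding yint_t_def by (simp add: algebra_simps)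
  have "slow = 1 / 1000000" by (simp add: slow_def)
  then show ?thesis unfolding eq using 1 2 3 4 by linarith
qed

lemma ysq_t_le: "\<bar>a * ysq_t g w g' w' a\<bar> \<le> 1 / 50"
proof -
  have A: "\<bar>g'\<bar> * a \<le> slow * 2" "\<bar>g'\<bar> * a\<^sup>2 \<le> slow * 4" using g'_le a_le a2_le a0 by auto
  have "\<bar>w'\<bar> * a ^ 3 \<le> 24 * slow * 8" "\<bar>w'\<bar> * a ^ 4 \<le> 24 * slow * 16" "\<bar>w'\<bar> * a ^ 5 \<le> 24 * slow * 32"
    using w'_le[OF pow_le(1)] w'_le[OF pow_le(2)] w'_le[OF pow_le(3)] a0 by auto
  then have B: "\<bar>w'\<bar> * a\<^sup>2 * a \<le> 24 * slow * 8" "\<bar>w'\<bar> * a ^ 3 * a \<le> 24 * slow * 16" "\<bar>w'\<bar> * a ^ 4 * a \<le> 24 * slow * 32"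
    by (simp_all add: eval_nat_numeral mult_ac)
  have "\<bar>g * (1 + ufun 0 w a) + 2 * ufun 1 w a\<bar> \<le> 12 + 6 * a"
  proof -
    have "\<bar>g * (1 + ufun 0 w a)\<bar> \<le> 3 * 4"
      using ufun_le[of 0] by (intro abs_mult_le g_sq) (auto simp: abs_le_iff)
    then show ?thesis using ufun_le[of 1] by (simp add: abs_le_iff)
  qed
  then have "\<bar>g'\<bar> * a * \<bar>g * (1 + ufun 0 w a) + 2 * ufun 1 w a\<bar> \<le> \<bar>g'\<bar> * a * (12 + 6 * a)"
    using a0 by (intro mult_left_mono) auto
  also have "\<bar>g'\<bar> * a * (12 + 6 * a) = 12 * (\<bar>g'\<bar> * a) + 6 * (\<bar>g'\<bar> * a\<^sup>2)"
    by (simp add: power2_eq_square algebra_simps)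
  finally have 1: "\<bar>a * (g' * (g * (1 + ufun 0 w a) + 2 * ufun 1 w a))\<bar> \<le> 48 * slow"
    using A a0 by (simp add: abs_mult[of a] abs_mult[of g'] mult_ac)
  have c: "\<bar>g\<^sup>2 / 2\<bar> \<le> 9 / 2" "\<bar>2 * g\<bar> \<le> 6" using g_sq by auto
  have G: "\<bar>a * (w' * (c * ufun_w k w a))\<bar> \<le> C * (3 / 2 * (real k + 1)) * (\<bar>w'\<bar> * a ^ (k + 2) * a)" if "\<bar>c\<bar> \<le> C" for c C k
  proof -
    have "\<bar>a * (w' * (c * ufun_w k w a))\<bar> \<le> a * (\<bar>c\<bar> * (3 / 2 * (real k + 1)) * (\<bar>w'\<bar> * a ^ (k + 2)))"
      using a0 by (intro abs_mult_le w'_ufun_w_le) auto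
    also have "\<dots> = \<bar>c\<bar> * (3 / 2 * (real k + 1) * (\<bar>w'\<bar> * a ^ (k + 2) * a))" by (simp add: mult_ac)
    also have "\<dots> \<le> C * (3 / 2 * (real k + 1) * (\<bar>w'\<bar> * a ^ (k + 2) * a))"
      using that a0 by (intro mult_right_mono) auto
    finally show ?thesis by (simp add: mult_ac)
  qed
  have 2: "\<bar>a * (w' * (g\<^sup>2 / 2 * ufun_w 0 w a))\<bar> \<le> 9 / 2 * (3 / 2) * (24 * slow * 8)"
    using G[OF c(1), of 0] B(1) by (simp flip: numeral_2_eq_2)
  have 3: "\<bar>a * (w' * (2 * g * ufun_w 1 w a))\<bar> \<le> 6 * 3 * (24 * slow * 16)"
    using G[OF c(2), of 1] B(2) by (simp flip: numeral_3_eq_3)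
  have 4: "\<bar>a * (w' * (2 * ufun_w 2 w a))\<bar> \<le> 2 * (9 / 2) * (24 * slow * 32)"
    using G[of 2 2 2] B(3) by simp
  have eq: "a * ysq_t g w g' w' a = a * (g' * (g * (1 + ufun 0 w a) + 2 * ufun 1 w a))
     + a * (w' * (g\<^sup>2 / 2 * ufun_w 0 w a)) + a * (w' * (2 * g * ufun_w 1 w a)) + a * (w' * (2 * ufun_w 2 w a))"
    unfolding ysq_t_def by (simp add: algebra_simps)
  have "slow = 1 / 1000000" by (simp add: slow_def)
  then show ?thesis unfolding eq using 1 2 3 4 by linarith
qed

end

section \<open>A slowly oscillating family of characteristics\<close>

definition amp :: "real \<Rightarrow> real" where "amp \<tau> = 2 + slow * sin (ln \<tau>)"
definition amp' :: "real \<Rightarrow> real" where "amp' \<tau> = slow * cos (ln \<tau>) / \<tau>"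
definition freq :: "real \<Rightarrow> real" where "freq \<tau> = 12 * slow * cos (ln \<tau>) / \<tau>"
definition freq' :: "real \<Rightarrow> real" where "freq' \<tau> = - 12 * slow * (sin (ln \<tau>) + cos (ln \<tau>)) / \<tau>\<^sup>2"

lemma amp_freq_deriv:
  assumes "\<tau> > 0"
  shows "(amp has_field_derivative amp' \<tau>) (at \<tau>)" "(freq has_field_derivative freq' \<tau>) (at \<tau>)"
  using assms unfolding amp_def[abs_def] freq_def[abs_def] amp'_def freq'_def
  by (auto intro!: derivative_eq_intros simp: field_simps power2_eq_square)

lemma freq_amp': "freq \<tau> = 12 * amp' \<tau>"
  by (simp add: freq_def amp'_def)

text \<open>Pairs \<open>(a, \<tau>)\<close> of the position on a characteristic and its exit time.\<close>
definition char_dom :: "(real \<times> real) set" where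
  "char_dom = {z. 0 \<le> fst z \<and> 1 \<le> snd z \<and> fst z ^ 3 \<le> 8 * snd z}"

lemma char_dom_is_char_domain:
  assumes "z \<in> char_dom"
  shows "char_domain_t (fst z) (snd z) (amp (snd z)) (freq (snd z)) (amp' (snd z)) (freq' (snd z))"
proof
  let ?t = "snd z"
  show "0 \<le> fst z" "1 \<le> ?t" "fst z ^ 3 \<le> 8 * ?t" using assms by (auto simp: char_dom_def)
  then have t: "?t > 0" by simp
  have s: "\<bar>sin (ln ?t)\<bar> \<le> 1" "\<bar>cos (ln ?t)\<bar> \<le> 1" by auto
  have "\<bar>slow * sin (ln ?t)\<bar> \<le> slow * 1" by (rule abs_mult_le[OF s(1)]) (simp add: slow_def)
  moreover have "slow \<le> 1" by (simp add: slow_def)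
  ultimately show "1 \<le> amp ?t" "amp ?t \<le> 3" unfolding amp_def by linarith+
  have c: "\<bar>slow * cos (ln ?t)\<bar> \<le> slow * 1" by (rule abs_mult_le[OF s(2)]) (simp add: slow_def)
  then show "\<bar>amp' ?t\<bar> \<le> slow / ?t" using t by (simp add: amp'_def divide_right_mono)
  have "\<bar>12 * slow * cos (ln ?t)\<bar> \<le> 12 * slow * 1" by (rule abs_mult_le[OF s(2)]) (simp add: slow_def)
  then show "\<bar>freq ?t\<bar> \<le> 12 * slow / ?t" using t by (simp add: freq_def divide_right_mono)
  have "\<bar>(- 12 * slow) * (sin (ln ?t) + cos (ln ?t))\<bar> \<le> 12 * slow * 2"
  proof (rule abs_mult_le)
    show "\<bar>sin (ln ?t) + cos (ln ?t)\<bar> \<le> 2" using s by linarith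
  qed (simp add: slow_def)
  then show "\<bar>freq' ?t\<bar> \<le> 24 * slow / ?t\<^sup>2" using t by (simp add: freq'_def divide_right_mono)
qed

text \<open>The quantities of the preceding sections as functions of \<open>(a, \<tau>)\<close>; \<open>2 * osc_half\<close> is the derivative of
  \<open>osc_sq\<close> in \<open>a\<close>.\<close>
definition osc_sq :: "real \<times> real \<Rightarrow> real" where "osc_sq z = ysq (amp (snd z)) (freq (snd z)) (fst z)"
definition osc_half :: "real \<times> real \<Rightarrow> real" where "osc_half z = ydy (amp (snd z)) (freq (snd z)) (fst z)"
definition osc_int :: "real \<times> real \<Rightarrow> real" where "osc_int z = yint (amp (snd z)) (freq (snd z)) (fst z)"
definition char_value :: "real \<times> real \<Rightarrow> real" where "char_value z = uval (amp (snd z)) (freq (snd z)) (fst z)"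
definition osc_sq_t :: "real \<times> real \<Rightarrow> real" where
  "osc_sq_t z = ysq_t (amp (snd z)) (freq (snd z)) (amp' (snd z)) (freq' (snd z)) (fst z)"
definition osc_int_t :: "real \<times> real \<Rightarrow> real" where
  "osc_int_t z = yint_t (amp (snd z)) (freq (snd z)) (amp' (snd z)) (freq' (snd z)) (fst z)"
definition char_slope :: "real \<times> real \<Rightarrow> real" where "char_slope z = 1 - fst z * osc_half z / osc_sq z"
definition char_rate :: "real \<times> real \<Rightarrow> real" where "char_rate z = freq (snd z) * (fst z)\<^sup>2 / 8"

definition char_place :: "real \<times> real \<Rightarrow> real" where "char_place z = fst z * osc_sq z"
definition char_time :: "real \<times> real \<Rightarrow> real" where "char_time z = snd z - 2 * osc_int z"

lemma char_dom_bounds: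
  assumes "z \<in> char_dom"
  shows "(1 + fst z)\<^sup>2 / 2 \<le> osc_sq z" "osc_sq z \<le> 20 * (1 + fst z)\<^sup>2" "0 < osc_sq z" "0 < osc_half z"
    "fst z * osc_half z \<le> osc_sq z" "fst z ^ 3 / 6 \<le> osc_int z" "osc_int z \<le> 10 * (fst z + (fst z)\<^sup>2 + fst z ^ 3)"
    "0 \<le> char_value z" "char_value z \<le> char_place z" "char_value z \<le> 15 * fst z * (1 + fst z)" "\<bar>osc_int_t z\<bar> \<le> 1 / 8" "\<bar>fst z * osc_sq_t z\<bar> \<le> 1 / 50"
proof -
  interpret char_domain_t "fst z" "snd z" "amp (snd z)" "freq (snd z)" "amp' (snd z)" "freq' (snd z)"
    by (rule char_dom_is_char_domain[OF assms])
  show "(1 + fst z)\<^sup>2 / 2 \<le> osc_sq z" "osc_sq z \<le> 20 * (1 + fst z)\<^sup>2" "0 < osc_sq z" "0 < osc_half z"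
    "fst z * osc_half z \<le> osc_sq z" "fst z ^ 3 / 6 \<le> osc_int z" "osc_int z \<le> 10 * (fst z + (fst z)\<^sup>2 + fst z ^ 3)"
    "0 \<le> char_value z" "char_value z \<le> char_place z" "char_value z \<le> 15 * fst z * (1 + fst z)" "\<bar>osc_int_t z\<bar> \<le> 1 / 8" "\<bar>fst z * osc_sq_t z\<bar> \<le> 1 / 50"
    unfolding osc_sq_def osc_half_def osc_int_def char_value_def osc_int_t_def osc_sq_t_def char_place_def
    using ysq_lower ysq_upper ysq_pos ydy_pos slope_nonneg yint_lower yint_upper uval_nonneg uval_le
      uval_upper yint_t_le ysq_t_le by blast+
qed

lemma char_dom_has_derivative:
  assumes "z \<in> char_dom"
  shows "(osc_sq has_derivative (\<lambda>h. 2 * osc_half z * fst h + osc_sq_t z * snd h)) (at z)"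
    "(osc_int has_derivative (\<lambda>h. osc_sq z * fst h + osc_int_t z * snd h)) (at z)"
    "(char_time has_derivative (\<lambda>h. - 2 * osc_sq z * fst h + (1 - 2 * osc_int_t z) * snd h)) (at z)"
    "(char_place has_derivative (\<lambda>h. (osc_sq z + 2 * fst z * osc_half z) * fst h + fst z * osc_sq_t z * snd h)) (at z)"
    "(char_value has_derivative (\<lambda>h. char_slope z * ((osc_sq z + 2 * fst z * osc_half z) * fst h + fst z * osc_sq_t z * snd h)
        + char_rate z * (- 2 * osc_sq z * fst h + (1 - 2 * osc_int_t z) * snd h))) (at z)"
proof -
  have t: "snd z > 0" using assms by (auto simp: char_dom_def)
  note d = amp_freq_deriv[OF t]
  show osc_sq: "(osc_sq has_derivative (\<lambda>h. 2 * osc_half z * fst h + osc_sq_t z * snd h)) (at z)"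
    unfolding osc_sq_def[abs_def] osc_half_def osc_sq_t_def by (rule ysq_has_derivative[OF d])
  show osc_int: "(osc_int has_derivative (\<lambda>h. osc_sq z * fst h + osc_int_t z * snd h)) (at z)"
    unfolding osc_sq_def osc_int_def[abs_def] osc_int_t_def by (rule yint_has_derivative[OF d])
  show "(char_time has_derivative (\<lambda>h. - 2 * osc_sq z * fst h + (1 - 2 * osc_int_t z) * snd h)) (at z)"
    unfolding char_time_def[abs_def]
    by (rule has_derivative_eq_rhs, (rule derivative_intros osc_int)+) (simp add: fun_eq_iff algebra_simps)
  show "(char_place has_derivative (\<lambda>h. (osc_sq z + 2 * fst z * osc_half z) * fst h + fst z * osc_sq_t z * snd h)) (at z)"
    unfolding char_place_def[abs_def]
    by (rule has_derivative_eq_rhs, (rule derivative_intros osc_sq)+) (simp add: fun_eq_iff algebra_simps)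
  have "osc_sq z \<noteq> 0" using char_dom_bounds(3)[OF assms] by simp
  then show "(char_value has_derivative (\<lambda>h. char_slope z * ((osc_sq z + 2 * fst z * osc_half z) * fst h + fst z * osc_sq_t z * snd h)
        + char_rate z * (- 2 * osc_sq z * fst h + (1 - 2 * osc_int_t z) * snd h))) (at z)"
    unfolding char_value_def[abs_def] char_slope_def char_rate_def osc_sq_def osc_half_def osc_int_t_def osc_sq_t_def
    by (intro uval_has_derivative[OF d freq_amp'])
qed

lemma partials_from_has_derivative:
  fixes f :: "real \<times> real \<Rightarrow> real"
  assumes "(f has_derivative (\<lambda>h. A * fst h + B * snd h)) (at (a, \<tau>))"
  shows "((\<lambda>a. f (a, \<tau>)) has_field_derivative A) (at a)"
    "((\<lambda>\<tau>. f (a, \<tau>)) has_field_derivative B) (at \<tau>)"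
proof -
  have 1: "((\<lambda>a. (a, \<tau>)) has_derivative (\<lambda>h. (h, 0))) (at a)"
   and 2: "((\<lambda>\<tau>. (a, \<tau>)) has_derivative (\<lambda>h. (0, h))) (at \<tau>)"
    by (auto intro!: derivative_eq_intros)
  show "((\<lambda>a. f (a, \<tau>)) has_field_derivative A) (at a)"
    "((\<lambda>\<tau>. f (a, \<tau>)) has_field_derivative B) (at \<tau>)"
    using has_derivative_compose[OF 1 assms] has_derivative_compose[OF 2 assms]
    by (simp_all add: has_field_derivative_def mult.commute[of _ A] mult.commute[of _ B])
qed

section \<open>Injectivity and surjectivity of the characteristic coordinates\<close>

text \<open>The set \<open>char_dom\<close> is not a rectangle, but two of its points with \<open>a1 \<le> a2\<close> and \<open>\<tau>1 \<le> \<tau>2\<close> can be joined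
  inside it via \<open>(a1, \<tau>2)\<close>, and the increments are estimated along this path.\<close>
lemma char_dom_left: "(a2, \<tau>) \<in> char_dom \<Longrightarrow> 0 \<le> a1 \<Longrightarrow> a1 \<le> a2 \<Longrightarrow> (a1, \<tau>) \<in> char_dom"
  unfolding char_dom_def using power_mono[of a1 a2 3] by (simp, linarith)

lemma char_dom_up: "(a, \<tau>1) \<in> char_dom \<Longrightarrow> \<tau>1 \<le> \<tau>2 \<Longrightarrow> (a, \<tau>2) \<in> char_dom"
  by (auto simp: char_dom_def)

lemma osc_sq_mono:
  assumes "(a2, \<tau>) \<in> char_dom" "0 \<le> a1" "a1 \<le> a2"
  shows "osc_sq (a1, \<tau>) \<le> osc_sq (a2, \<tau>)"
proof (rule DERIV_nonneg_imp_nondecreasing[OF assms(3)])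
  fix a assume "a1 \<le> a" "a \<le> a2"
  then have "(a, \<tau>) \<in> char_dom" using char_dom_left assms by auto
  from partials_from_has_derivative(1)[OF char_dom_has_derivative(1)[OF this]] char_dom_bounds(4)[OF this]
  show "\<exists>y. ((\<lambda>a. osc_sq (a, \<tau>)) has_real_derivative y) (at a) \<and> 0 \<le> y"
    by (intro exI[of _ "2 * osc_half (a, \<tau>)"]) simp
qed

lemma osc_int_increment_a:
  assumes "(a2, \<tau>) \<in> char_dom" "0 \<le> a1" "a1 < a2"
  shows "0 < osc_int (a2, \<tau>) - osc_int (a1, \<tau>)" "osc_int (a2, \<tau>) - osc_int (a1, \<tau>) \<le> (a2 - a1) * osc_sq (a2, \<tau>)"
proof -
  have D: "(a, \<tau>) \<in> char_dom" if "a1 \<le> a" "a \<le> a2" for a using char_dom_left assms that by auto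
  obtain c where c: "a1 < c" "c < a2" "osc_int (a2, \<tau>) - osc_int (a1, \<tau>) = (a2 - a1) * osc_sq (c, \<tau>)"
    using MVT2[OF assms(3), of "\<lambda>a. osc_int (a, \<tau>)" "\<lambda>a. osc_sq (a, \<tau>)"]
      partials_from_has_derivative(1)[OF char_dom_has_derivative(2)[OF D]] by auto
  show "0 < osc_int (a2, \<tau>) - osc_int (a1, \<tau>)"
    unfolding c(3) using char_dom_bounds(3)[OF D[of c]] c assms(3) by simp
  show "osc_int (a2, \<tau>) - osc_int (a1, \<tau>) \<le> (a2 - a1) * osc_sq (a2, \<tau>)"
    unfolding c(3) using osc_sq_mono[OF assms(1), of c] c assms by (intro mult_left_mono) auto
qed

lemma exit_time_increments:
  assumes "(a, \<tau>1) \<in> char_dom" "\<tau>1 \<le> \<tau>2"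
  shows "\<bar>osc_int (a, \<tau>2) - osc_int (a, \<tau>1)\<bar> \<le> (\<tau>2 - \<tau>1) / 8"
    "\<bar>a * osc_sq (a, \<tau>2) - a * osc_sq (a, \<tau>1)\<bar> \<le> (\<tau>2 - \<tau>1) / 50"
proof -
  have "\<bar>osc_int (a, \<tau>2) - osc_int (a, \<tau>1)\<bar> \<le> (\<tau>2 - \<tau>1) / 8 \<and>
    \<bar>a * osc_sq (a, \<tau>2) - a * osc_sq (a, \<tau>1)\<bar> \<le> (\<tau>2 - \<tau>1) / 50"
  proof (cases "\<tau>1 = \<tau>2")
    case False
    then have lt: "\<tau>1 < \<tau>2" using assms by simp
    have D: "(a, \<tau>) \<in> char_dom" if "\<tau>1 \<le> \<tau>" for \<tau> using char_dom_up assms that by auto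
    obtain c where c: "\<tau>1 < c" "c < \<tau>2" "osc_int (a, \<tau>2) - osc_int (a, \<tau>1) = (\<tau>2 - \<tau>1) * osc_int_t (a, c)"
      using MVT2[OF lt, of "\<lambda>\<tau>. osc_int (a, \<tau>)" "\<lambda>\<tau>. osc_int_t (a, \<tau>)"]
        partials_from_has_derivative(2)[OF char_dom_has_derivative(2)[OF D]] by auto
    have "\<bar>(\<tau>2 - \<tau>1) * osc_int_t (a, c)\<bar> \<le> (\<tau>2 - \<tau>1) * (1 / 8)"
      using char_dom_bounds(11)[OF D[of c]] c lt by (intro abs_mult_le) auto
    moreover have "((\<lambda>\<tau>. a * osc_sq (a, \<tau>)) has_real_derivative a * osc_sq_t (a, \<tau>)) (at \<tau>)" if "\<tau>1 \<le> \<tau>" for \<tau>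
      using partials_from_has_derivative(2)[OF char_dom_has_derivative(1)[OF D[OF that]]]
      by (auto intro!: derivative_eq_intros)
    then obtain d where d: "\<tau>1 < d" "d < \<tau>2" "a * osc_sq (a, \<tau>2) - a * osc_sq (a, \<tau>1) = (\<tau>2 - \<tau>1) * (a * osc_sq_t (a, d))"
      using MVT2[OF lt, of "\<lambda>\<tau>. a * osc_sq (a, \<tau>)" "\<lambda>\<tau>. a * osc_sq_t (a, \<tau>)"] by auto
    have "\<bar>(\<tau>2 - \<tau>1) * (a * osc_sq_t (a, d))\<bar> \<le> (\<tau>2 - \<tau>1) * (1 / 50)"
      using char_dom_bounds(12)[OF D[of d]] d lt by (intro abs_mult_le) auto
    ultimately show ?thesis unfolding c(3) d(3) by simp
  qed simp
  then show "\<bar>osc_int (a, \<tau>2) - osc_int (a, \<tau>1)\<bar> \<le> (\<tau>2 - \<tau>1) / 8"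
    "\<bar>a * osc_sq (a, \<tau>2) - a * osc_sq (a, \<tau>1)\<bar> \<le> (\<tau>2 - \<tau>1) / 50" by auto
qed

lemma char_time_increment_t:
  assumes "(a, \<tau>1) \<in> char_dom" "\<tau>1 \<le> \<tau>2"
  shows "3 / 4 * (\<tau>2 - \<tau>1) \<le> char_time (a, \<tau>2) - char_time (a, \<tau>1)"
  using abs_le_D1[OF exit_time_increments(1)[OF assms]] unfolding char_time_def by simp

text \<open>Characteristics do not cross. Going up in \<open>a\<close> lowers the time at the rate \<open>2 * osc_sq\<close>, so an equal time needs
  a later exit, by an amount controlled by the increase of \<open>a\<close>. The change of the place caused by the later exit
  is then at most a small fraction of the increase caused by \<open>a\<close>.\<close>
lemma equal_time_order:
  assumes "(a1, \<tau>1) \<in> char_dom" "(a2, \<tau>2) \<in> char_dom" "char_time (a1, \<tau>1) = char_time (a2, \<tau>2)" "a1 < a2"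
  shows "\<tau>1 < \<tau>2" "\<tau>2 - \<tau>1 \<le> 4 * (a2 - a1) * osc_sq (a2, \<tau>2)" "char_place (a1, \<tau>1) < char_place (a2, \<tau>2)"
proof -
  have a1: "0 \<le> a1" using assms(1) by (auto simp: char_dom_def)
  note Ia = osc_int_increment_a[OF assms(2) a1 assms(4)]
  have D: "(a1, \<tau>2) \<in> char_dom" using char_dom_left[OF assms(2) a1] assms(4) by simp
  show lt: "\<tau>1 < \<tau>2"
  proof (rule ccontr)
    assume "\<not> ?thesis"
    then have "3 / 4 * (\<tau>1 - \<tau>2) \<le> char_time (a1, \<tau>1) - char_time (a1, \<tau>2)" "\<tau>2 \<le> \<tau>1"
      using char_time_increment_t[OF D] by auto
    then show False using Ia(1) assms(3) unfolding char_time_def by simp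
  qed
  note osc_int_t = exit_time_increments[OF assms(1) less_imp_le[OF lt]]
  define W where "W = (a2 - a1) * osc_sq (a2, \<tau>2)"
  have "\<tau>2 - \<tau>1 = 2 * (osc_int (a2, \<tau>2) - osc_int (a1, \<tau>2)) + 2 * (osc_int (a1, \<tau>2) - osc_int (a1, \<tau>1))"
    using assms(3) unfolding char_time_def by simp
  then have le: "\<tau>2 - \<tau>1 \<le> 8 / 3 * W"
    using Ia(2) abs_le_D1[OF osc_int_t(1)] unfolding W_def by argo
  have Y2: "osc_sq (a2, \<tau>2) > 0" by (rule char_dom_bounds[OF assms(2)])
  then have W: "W > 0" unfolding W_def using assms(4) by simp
  then show "\<tau>2 - \<tau>1 \<le> 4 * (a2 - a1) * osc_sq (a2, \<tau>2)" using le unfolding W_def by argo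
  have "a1 * osc_sq (a1, \<tau>2) \<le> a1 * osc_sq (a2, \<tau>2)"
    using osc_sq_mono[OF assms(2) a1] assms(4) a1 by (intro mult_left_mono) auto
  then have "W \<le> a2 * osc_sq (a2, \<tau>2) - a1 * osc_sq (a1, \<tau>2)" unfolding W_def by (simp add: algebra_simps)
  then show "char_place (a1, \<tau>1) < char_place (a2, \<tau>2)"
    using le W abs_le_D2[OF osc_int_t(2)] unfolding char_place_def fst_conv by argo
qed

lemma char_param_inj:
  assumes "z1 \<in> char_dom" "z2 \<in> char_dom" "char_time z1 = char_time z2" "char_place z1 = char_place z2"
  shows "z1 = z2"
proof -
  obtain a1 \<tau>1 a2 \<tau>2 where z: "z1 = (a1, \<tau>1)" "z2 = (a2, \<tau>2)" by (cases z1, cases z2) auto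
  have a: "a1 = a2"
    using equal_time_order(3)[of a1 \<tau>1 a2 \<tau>2] equal_time_order(3)[of a2 \<tau>2 a1 \<tau>1] assms unfolding z
    by (cases a1 a2 rule: linorder_cases) auto
  moreover have "\<tau>1 = \<tau>2"
    using char_time_increment_t[of a1 \<tau>1 \<tau>2] char_time_increment_t[of a1 \<tau>2 \<tau>1] assms unfolding z a
    by (cases \<tau>1 \<tau>2 rule: linorder_cases) auto
  ultimately show ?thesis unfolding z by simp
qed

text \<open>On the part of the boundary that does not belong to \<open>x = 0\<close> the time is at most 1; so the points with time above 1
  that do not lie on \<open>x = 0\<close> are interior to \<open>char_dom\<close>.\<close>
lemma char_time_boundary:
  assumes "(a, \<tau>) \<in> char_dom" "\<tau> = 1 \<or> a ^ 3 = 8 * \<tau>"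
  shows "char_time (a, \<tau>) \<le> 1"
proof -
  have "0 \<le> a ^ 3" "a ^ 3 / 6 \<le> osc_int (a, \<tau>)"
    using assms(1) char_dom_bounds(6)[OF assms(1)] by (auto simp: char_dom_def)
  then show ?thesis using assms(2) unfolding char_time_def snd_conv by argo
qed

lemma exit_time_exists:
  assumes "0 \<le> a" "1 \<le> t"
  shows "\<exists>\<tau>. (a, \<tau>) \<in> char_dom \<and> char_time (a, \<tau>) = t"
proof -
  (* m is the least exit time admitted in char_dom; at M the time is at least t by the upper bound on osc_int. *)
  define m where "m = max 1 (a ^ 3 / 8)"
  define M where "M = max m (t + 20 * (a + a\<^sup>2 + a ^ 3))"
  have D: "(a, \<tau>) \<in> char_dom" if "m \<le> \<tau>" for \<tau> using that assms(1) by (auto simp: char_dom_def m_def)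
  have m: "char_time (a, m) \<le> t"
    using char_time_boundary[OF D[of m]] assms(2) by (auto simp: m_def max_def split: if_splits)
  have mM: "m \<le> M" by (simp add: M_def)
  have "osc_int (a, M) \<le> 10 * (a + a\<^sup>2 + a ^ 3)" using char_dom_bounds(7)[OF D[OF mM]] by simp
  moreover have "t + 20 * (a + a\<^sup>2 + a ^ 3) \<le> M" by (simp add: M_def)
  ultimately have M: "t \<le> char_time (a, M)" unfolding char_time_def by simp
  have "continuous_on {m..M} (\<lambda>\<tau>. char_time (a, \<tau>))"
    by (rule DERIV_continuous_on[OF has_field_derivative_at_within], rule partials_from_has_derivative(2)[OF char_dom_has_derivative(3)])
      (use D in auto)
  from IVT'[OF m M mM this] obtain \<tau> where "m \<le> \<tau>" "char_time (a, \<tau>) = t" by auto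
  then show ?thesis using D by blast
qed

text \<open>The exit time of the characteristic that has parameter \<open>a\<close> at time \<open>t\<close>.\<close>
definition exit_time :: "real \<Rightarrow> real \<Rightarrow> real" where
  "exit_time t a = (SOME \<tau>. (a, \<tau>) \<in> char_dom \<and> char_time (a, \<tau>) = t)"

lemma exit_time:
  assumes "0 \<le> a" "1 \<le> t"
  shows "(a, exit_time t a) \<in> char_dom" "char_time (a, exit_time t a) = t"
  using someI_ex[OF exit_time_exists[OF assms]] unfolding exit_time_def by auto

lemma exit_time_lipschitz:
  assumes "0 \<le> a1" "a1 \<le> a2" "a2 \<le> A" "1 \<le> t"
  shows "\<bar>exit_time t a2 - exit_time t a1\<bar> \<le> 80 * (1 + A)\<^sup>2 * (a2 - a1)"
proof (cases "a1 = a2")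
  case False
  then have lt: "a1 < a2" and a2: "0 \<le> a2" using assms by auto
  note e1 = exit_time[OF assms(1,4)] and e2 = exit_time[OF a2 assms(4)]
  note st = equal_time_order[OF e1(1) e2(1) _ lt, unfolded e1(2) e2(2), OF refl]
  have "osc_sq (a2, exit_time t a2) \<le> 20 * (1 + a2)\<^sup>2" using char_dom_bounds(2)[OF e2(1)] by simp
  also have "\<dots> \<le> 20 * (1 + A)\<^sup>2" using assms a2 by (intro mult_left_mono power_mono) auto
  finally have "4 * (a2 - a1) * osc_sq (a2, exit_time t a2) \<le> 4 * (a2 - a1) * (20 * (1 + A)\<^sup>2)"
    using lt by (intro mult_left_mono) auto
  then show ?thesis using st(1,2) by (simp add: algebra_simps)
qed simp

lemma char_param_surj:
  assumes "0 < x" "1 < t"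
  shows "\<exists>z\<in>char_dom. char_time z = t \<and> char_place z = x"
proof -
  (* The place at a = A is at least A / 2 = x, because osc_sq is at least 1 / 2. *)
  define A where "A = 2 * x"
  have A: "A > 0" using assms by (simp add: A_def)
  let ?z = "\<lambda>a. (a, exit_time t a)"
  have D: "?z a \<in> char_dom" "char_time (?z a) = t" if "0 \<le> a" for a using exit_time[OF that, of t] assms by auto
  have "(80 * (1 + A)\<^sup>2)-lipschitz_on {0..A} (exit_time t)"
  proof (rule lipschitz_onI)
    fix a b assume "a \<in> {0..A}" "b \<in> {0..A}"
    then show "dist (exit_time t a) (exit_time t b) \<le> 80 * (1 + A)\<^sup>2 * dist a b"
      using exit_time_lipschitz[of a b A t] exit_time_lipschitz[of b a A t] assms(2)
      by (cases "a \<le> b") (auto simp: dist_real_def abs_minus_commute)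
  qed simp
  then have "continuous_on {0..A} (exit_time t)" by (rule lipschitz_on_continuous_on)
  then have c: "continuous_on {0..A} ?z" by (intro continuous_intros)
  have "continuous_on (?z ` {0..A}) char_place"
    by (rule continuous_at_imp_continuous_on) (use D has_derivative_continuous[OF char_dom_has_derivative(4)] in auto)
  then have cont: "continuous_on {0..A} (\<lambda>a. char_place (?z a))"
    using continuous_on_compose2[OF _ c] by blast
  have "1 * 1 \<le> (1 + A) * (1 + A)" using A by (intro mult_mono) auto
  then have "1 / 2 \<le> osc_sq (?z A)" using char_dom_bounds(1)[OF D(1)[of A]] A by (simp add: power2_eq_square)
  then have "A * (1 / 2) \<le> char_place (?z A)" unfolding char_place_def fst_conv using A by (intro mult_left_mono) auto
  then have "x \<le> char_place (?z A)" by (simp add: A_def)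
  moreover have "char_place (?z 0) \<le> x" using assms by (simp add: char_place_def)
  ultimately obtain a where "0 \<le> a" "char_place (?z a) = x"
    using IVT'[of "\<lambda>a. char_place (?z a)" 0 x A] cont A by auto
  then show ?thesis using D[of a] by blast
qed


section \<open>The classical solution\<close>

definition char_dom_int :: "(real \<times> real) set" where
  "char_dom_int = {z. 0 < fst z \<and> 1 < snd z \<and> fst z ^ 3 < 8 * snd z}"

lemma char_dom_int_subset: "z \<in> char_dom_int \<Longrightarrow> z \<in> char_dom"
  by (auto simp: char_dom_def char_dom_int_def)

lemma open_char_dom_int: "open char_dom_int"
  unfolding char_dom_int_def by (intro open_Collect_conj open_Collect_less continuous_intros)

definition char_param :: "real \<times> real \<Rightarrow> real \<times> real" where
  "char_param z = (char_place z, char_time z)"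

definition char_coord :: "real \<times> real \<Rightarrow> real \<times> real" where
  "char_coord p = (THE z. z \<in> char_dom \<and> char_param z = p)"

lemma char_coord_param: "z \<in> char_dom \<Longrightarrow> char_coord (char_param z) = z"
  unfolding char_coord_def by (rule the_equality) (auto simp: char_param_def intro: char_param_inj)

lemma char_coord:
  assumes "0 < fst p" "1 < snd p"
  shows "char_coord p \<in> char_dom_int" "char_param (char_coord p) = p"
proof -
  obtain z where z: "z \<in> char_dom" "char_param z = p"
    using char_param_surj[OF assms] by (auto simp: char_param_def)
  then have c: "char_coord p = z" using char_coord_param by blast
  then show "char_param (char_coord p) = p" using z by simp
  have "fst z \<noteq> 0" using z assms by (auto simp: char_param_def char_place_def)
  moreover have "snd z \<noteq> 1" "fst z ^ 3 \<noteq> 8 * snd z"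
    using char_time_boundary[of "fst z" "snd z"] z assms by (auto simp: char_param_def)
  ultimately show "char_coord p \<in> char_dom_int" using z(1) unfolding c char_dom_def char_dom_int_def by auto
qed

definition char_jac :: "real \<times> real \<Rightarrow> real" where
  "char_jac z = (osc_sq z + 2 * fst z * osc_half z) * (1 - 2 * osc_int_t z) + 2 * osc_sq z * (fst z * osc_sq_t z)"

lemma char_jac_pos:
  assumes "z \<in> char_dom"
  shows "char_jac z > 0"
proof -
  note b = char_dom_bounds[OF assms]
  have a: "0 \<le> fst z" using assms by (auto simp: char_dom_def)
  have "osc_sq z * (3 / 4) \<le> (osc_sq z + 2 * fst z * osc_half z) * (1 - 2 * osc_int_t z)"
    using b(3,4) abs_le_D1[OF b(11)] a by (intro mult_mono) auto
  moreover have "\<bar>2 * osc_sq z * (fst z * osc_sq_t z)\<bar> \<le> 2 * osc_sq z * (1 / 50)"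
    using b(3) by (intro abs_mult_le b(12)) auto
  ultimately show ?thesis using b(3) unfolding char_jac_def by (simp add: abs_le_iff)
qed

text \<open>Cramer's rule for the Jacobian matrix of \<open>char_param\<close>.\<close>
lemma char_jac_inverse:
  assumes "char_jac z \<noteq> 0"
  shows "(osc_sq z + 2 * fst z * osc_half z) * (((1 - 2 * osc_int_t z) * k1 - fst z * osc_sq_t z * k2) / char_jac z)
         + fst z * osc_sq_t z * ((2 * osc_sq z * k1 + (osc_sq z + 2 * fst z * osc_half z) * k2) / char_jac z) = k1"
    "- 2 * osc_sq z * (((1 - 2 * osc_int_t z) * k1 - fst z * osc_sq_t z * k2) / char_jac z)
         + (1 - 2 * osc_int_t z) * ((2 * osc_sq z * k1 + (osc_sq z + 2 * fst z * osc_half z) * k2) / char_jac z) = k2"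
proof -
  have gen: "A * ((D * k1 - B * k2) / J) + B * ((C * k1 + A * k2) / J) = k1"
    "- C * ((D * k1 - B * k2) / J) + D * ((C * k1 + A * k2) / J) = k2"
    if "J = A * D + C * B" "J \<noteq> 0" for A B C D J :: real
  proof -
    have "A * (D * k1 - B * k2) + B * (C * k1 + A * k2) = k1 * J"
      "- C * (D * k1 - B * k2) + D * (C * k1 + A * k2) = k2 * J"
      unfolding that(1) by (simp_all add: algebra_simps)
    then have "(A * (D * k1 - B * k2) + B * (C * k1 + A * k2)) / J = k1"
      "(- C * (D * k1 - B * k2) + D * (C * k1 + A * k2)) / J = k2"
      using that(2) by simp_all
    then show "A * ((D * k1 - B * k2) / J) + B * ((C * k1 + A * k2) / J) = k1"
      "- C * ((D * k1 - B * k2) / J) + D * ((C * k1 + A * k2) / J) = k2"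
      by (simp_all only: add_divide_distrib[symmetric] times_divide_eq_right)
  qed
  show "(osc_sq z + 2 * fst z * osc_half z) * (((1 - 2 * osc_int_t z) * k1 - fst z * osc_sq_t z * k2) / char_jac z)
         + fst z * osc_sq_t z * ((2 * osc_sq z * k1 + (osc_sq z + 2 * fst z * osc_half z) * k2) / char_jac z) = k1"
    "- 2 * osc_sq z * (((1 - 2 * osc_int_t z) * k1 - fst z * osc_sq_t z * k2) / char_jac z)
         + (1 - 2 * osc_int_t z) * ((2 * osc_sq z * k1 + (osc_sq z + 2 * fst z * osc_half z) * k2) / char_jac z) = k2"
    using gen[OF char_jac_def assms] by auto
qed

lemma char_coord_has_derivative:
  assumes "0 < fst p" "1 < snd p"
  defines "z \<equiv> char_coord p"
  shows "(char_coord has_derivative (\<lambda>k. (((1 - 2 * osc_int_t z) * fst k - fst z * osc_sq_t z * snd k) / char_jac z,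
      (2 * osc_sq z * fst k + (osc_sq z + 2 * fst z * osc_half z) * snd k) / char_jac z))) (at p)"
proof (rule has_derivative_inverse_strong_x[where f = char_param and S = char_dom_int])
  note c = char_coord[OF assms(1,2), folded z_def]
  show "open char_dom_int" by (rule open_char_dom_int)
  show "char_coord p \<in> char_dom_int" "char_param (char_coord p) = p" using char_coord[OF assms(1,2)] by auto
  have d: "(char_param has_derivative (\<lambda>h. ((osc_sq z + 2 * fst z * osc_half z) * fst h + fst z * osc_sq_t z * snd h,
      - 2 * osc_sq z * fst h + (1 - 2 * osc_int_t z) * snd h))) (at z)" if "z \<in> char_dom_int" for z
    unfolding char_param_def[abs_def] using that
    by (intro has_derivative_Pair char_dom_has_derivative char_dom_int_subset)
  show "(char_param has_derivative (\<lambda>h. ((osc_sq z + 2 * fst z * osc_half z) * fst h + fst z * osc_sq_t z * snd h,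
      - 2 * osc_sq z * fst h + (1 - 2 * osc_int_t z) * snd h))) (at (char_coord p))"
    using d[OF c(1)] by (simp add: z_def)
  show "continuous_on char_dom_int char_param"
    by (rule continuous_at_imp_continuous_on) (use d has_derivative_continuous in blast)
  show "char_coord (char_param z) = z" if "z \<in> char_dom_int" for z
    by (rule char_coord_param[OF char_dom_int_subset[OF that]])
  have j: "char_jac z \<noteq> 0" using char_jac_pos[OF char_dom_int_subset[OF c(1)]] by simp
  show "(\<lambda>h. ((osc_sq z + 2 * fst z * osc_half z) * fst h + fst z * osc_sq_t z * snd h,
      - 2 * osc_sq z * fst h + (1 - 2 * osc_int_t z) * snd h)) \<circ>
     (\<lambda>k. (((1 - 2 * osc_int_t z) * fst k - fst z * osc_sq_t z * snd k) / char_jac z,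
      (2 * osc_sq z * fst k + (osc_sq z + 2 * fst z * osc_half z) * snd k) / char_jac z)) = id"
    unfolding comp_def fst_conv snd_conv char_jac_inverse[OF j] by (simp add: fun_eq_iff)
qed

definition sol :: "real \<times> real \<Rightarrow> real" where "sol p = char_value (char_coord p)"
definition sol_x :: "real \<times> real \<Rightarrow> real" where "sol_x p = char_slope (char_coord p)"
definition sol_t :: "real \<times> real \<Rightarrow> real" where "sol_t p = char_rate (char_coord p)"

text \<open>By \<open>uval_has_derivative\<close> the differential of the value in characteristic coordinates is already a
  combination of the differentials of place and time; the inverse Jacobian turns these into \<open>dx\<close> and \<open>dt\<close>.\<close>
lemma sol_has_derivative:
  assumes "0 < fst p" "1 < snd p"
  shows "(sol has_derivative (\<lambda>k. sol_x p * fst k + sol_t p * snd k)) (at p)"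
proof -
  define z where "z = char_coord p"
  have D: "z \<in> char_dom" using char_dom_int_subset[OF char_coord(1)[OF assms]] by (simp add: z_def)
  note dc = char_coord_has_derivative[OF assms, folded z_def]
  have j: "char_jac z \<noteq> 0" using char_jac_pos[OF D] by simp
  have "((\<lambda>p. char_value (char_coord p)) has_derivative (\<lambda>k. char_slope z * fst k + char_rate z * snd k)) (at p)"
    using has_derivative_compose[OF dc char_dom_has_derivative(5)[OF D, unfolded z_def], folded z_def]
    unfolding fst_conv snd_conv char_jac_inverse[OF j] .
  then show ?thesis unfolding sol_def[abs_def] sol_x_def sol_t_def z_def[symmetric] .
qed

lemma char_dom_continuous:
  assumes "z \<in> char_dom"
  shows "isCont char_slope z" "isCont char_rate z"
proof -
  have t: "snd z > 0" using assms by (auto simp: char_dom_def)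
  have "isCont osc_half z"
    unfolding osc_half_def[abs_def] using has_derivative_continuous[OF ydy_has_derivative[OF amp_freq_deriv[OF t]]] .
  moreover have "isCont osc_sq z" using has_derivative_continuous[OF char_dom_has_derivative(1)[OF assms]] .
  ultimately show "isCont char_slope z" unfolding char_slope_def[abs_def]
    using char_dom_bounds(3)[OF assms] by (intro continuous_intros) auto
  have "isCont freq (snd z)" using DERIV_isCont[OF amp_freq_deriv(2)[OF t]] .
  then have "isCont (\<lambda>z. freq (snd z)) z" by (intro isCont_o2[of z snd freq]) auto
  then show "isCont char_rate z" unfolding char_rate_def[abs_def] by (intro continuous_intros) auto
qed

lemma sol_partials_continuous:
  "continuous_on ({0<..} \<times> {1<..}) sol_x" "continuous_on ({0<..} \<times> {1<..}) sol_t"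
proof -
  have "isCont sol_x p \<and> isCont sol_t p" if "p \<in> {0<..} \<times> {1<..}" for p
  proof -
    have p: "0 < fst p" "1 < snd p" using that by (auto simp: mem_Times_iff)
    have c: "isCont char_coord p" using has_derivative_continuous[OF char_coord_has_derivative[OF p]] .
    show ?thesis
      unfolding sol_x_def[abs_def] sol_t_def[abs_def]
      using char_dom_continuous[OF char_dom_int_subset[OF char_coord(1)[OF p]]] isCont_o2[OF c] by blast
  qed
  then show "continuous_on ({0<..} \<times> {1<..}) sol_x" "continuous_on ({0<..} \<times> {1<..}) sol_t"
    by (auto intro!: continuous_at_imp_continuous_on)
qed

text \<open>The equation contains no explicit time, hence the arbitrary \<open>s\<close>. The last bound is a growth of order
  \<open>x powr (2/3)\<close> that is uniform in time: with \<open>e = 1 + a\<close> the value is at most \<open>30 x / e\<close>, and \<open>x \<le> 20 e ^ 3\<close>.\<close>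
lemma sol_properties:
  assumes "0 < x" "1 < t"
  shows "cf_operator (x, s) (sol (x, t)) (sol_x (x, t)) (sol_t (x, t)) = 0"
    "0 \<le> sol (x, t)" "sol (x, t) \<le> x" "0 \<le> sol_x (x, t)" "sol_x (x, t) \<le> 1"
    "sol (x, t) ^ 3 \<le> 540000 * x\<^sup>2"
proof -
  define z where "z = char_coord (x, t)"
  have c: "z \<in> char_dom_int" "char_place z = x"
    using char_coord[of "(x, t)"] assms by (auto simp: z_def char_param_def)
  note D = char_dom_int_subset[OF c(1)]
  note b = char_dom_bounds[OF D]
  have a: "fst z > 0" using c by (auto simp: char_dom_int_def)
  have s: "sol (x, t) = char_value z" "sol_x (x, t) = char_slope z" "sol_t (x, t) = char_rate z"
    unfolding sol_def sol_x_def sol_t_def z_def by auto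
  show "0 \<le> sol (x, t)" "sol (x, t) \<le> x" using b c s by auto
  show "0 \<le> sol_x (x, t)" "sol_x (x, t) \<le> 1" using b a unfolding s char_slope_def by auto
  show "cf_operator (x, s) (sol (x, t)) (sol_x (x, t)) (sol_t (x, t)) = 0"
  proof -
    have "char_rate z + 1 / 2 * (char_slope z - 1) * (char_slope z - 2) + char_value z / (fst z * osc_sq z) - 1 = 0"
      using uval_solves_equation[of "amp (snd z)" "freq (snd z)" "fst z"] a b(3)
      unfolding char_rate_def char_slope_def char_value_def osc_sq_def osc_half_def by simp
    then show ?thesis using c(2) unfolding cf_operator_def s char_place_def by simp
  qed
  show "sol (x, t) ^ 3 \<le> 540000 * x\<^sup>2"
  proof -
    define e where "e = 1 + fst z"
    have e: "e > 0" using a by (simp add: e_def)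
    have x: "x = fst z * osc_sq z" using c by (simp add: char_place_def)
    have "fst z * (e\<^sup>2 / 2) \<le> x" unfolding x e_def using b(1) a by (intro mult_left_mono) auto
    moreover have "char_value z * e \<le> 15 * fst z * e * e" unfolding e_def using b(10) a by (intro mult_right_mono) auto
    ultimately have 1: "char_value z * e \<le> 30 * x" by (simp add: power2_eq_square)
    have "x \<le> fst z * (20 * e\<^sup>2)" unfolding x e_def using b(2) a by (intro mult_left_mono) auto
    also have "\<dots> \<le> e * (20 * e\<^sup>2)" using a by (intro mult_right_mono) (auto simp: e_def)
    finally have 2: "x \<le> 20 * e ^ 3" by (simp add: power2_eq_square power3_eq_cube)
    have "char_value z ^ 3 * e ^ 3 \<le> (30 * x) ^ 3"
      using power_mono[OF 1, of 3] b(8) e by (simp add: power_mult_distrib)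
    also have "\<dots> = 27000 * x\<^sup>2 * x" by (simp add: power2_eq_square power3_eq_cube)
    also have "\<dots> \<le> 27000 * x\<^sup>2 * (20 * e ^ 3)" using 2 by (intro mult_left_mono) auto
    finally have "char_value z ^ 3 * e ^ 3 \<le> (540000 * x\<^sup>2) * e ^ 3" by simp
    then show ?thesis using e unfolding s by simp
  qed
qed

section \<open>Comparison of viscosity solutions with a classical solution\<close>

lemma local_min_has_derivative_zero:
  fixes f :: "real \<times> real \<Rightarrow> real"
  assumes "(f has_derivative (\<lambda>(h, k). A * h + B * k)) (at z)"
    and "\<forall>\<^sub>F w in nhds z. f z \<le> f w"
  shows "A = 0" "B = 0"
proof -
  have "\<forall>\<^sub>F w in at z. f z \<le> f w"
    using assms(2) by (simp add: eventually_nhds_conv_at)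
  then have "(\<lambda>(h, k). A * h + B * k) = (\<lambda>h. 0)"
    by (rule has_derivative_local_min[OF assms(1)])
  from fun_cong[OF this, of "(1, 0)"] fun_cong[OF this, of "(0, 1)"]
  show "A = 0" "B = 0" by auto
qed

lemma classical_solution_is_viscosity_solution:
  assumes C1: "C1_with_partials W u ux ut"
    and eq: "\<And>z. z \<in> W \<Longrightarrow> E z (u z) (ux z) (ut z) = 0"
  shows "viscosity_subsolution E W u" "viscosity_supersolution E W u"
proof -
  have d: "((\<lambda>w. u w - \<phi> w) has_derivative (\<lambda>(h, k). (ux z - \<phi>x z) * h + (ut z - \<phi>t z) * k)) (at z)"
     "((\<lambda>w. \<phi> w - u w) has_derivative (\<lambda>(h, k). (\<phi>x z - ux z) * h + (\<phi>t z - ut z) * k)) (at z)"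
    if "C1_with_partials W \<phi> \<phi>x \<phi>t" "z \<in> W" for \<phi> \<phi>x \<phi>t z
  proof -
    have "(u has_derivative (\<lambda>(h, k). ux z * h + ut z * k)) (at z)"
      "(\<phi> has_derivative (\<lambda>(h, k). \<phi>x z * h + \<phi>t z * k)) (at z)"
      using C1 that by (auto simp: C1_with_partials_def)
    from has_derivative_diff[OF this] has_derivative_diff[OF this(2,1)]
    show "((\<lambda>w. u w - \<phi> w) has_derivative (\<lambda>(h, k). (ux z - \<phi>x z) * h + (ut z - \<phi>t z) * k)) (at z)"
     "((\<lambda>w. \<phi> w - u w) has_derivative (\<lambda>(h, k). (\<phi>x z - ux z) * h + (\<phi>t z - ut z) * k)) (at z)"
      by (auto elim!: has_derivative_eq_rhs simp: algebra_simps)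
  qed
  show "viscosity_subsolution E W u"
    unfolding viscosity_subsolution_def
  proof (intro allI impI ballI)
    fix \<phi> \<phi>x \<phi>t z
    assume a: "C1_with_partials W \<phi> \<phi>x \<phi>t" "z \<in> W" "\<forall>\<^sub>F w in nhds z. u w - \<phi> w \<le> u z - \<phi> z"
    have "\<forall>\<^sub>F w in nhds z. \<phi> z - u z \<le> \<phi> w - u w"
      using a(3) by eventually_elim simp
    from local_min_has_derivative_zero[OF d(2)[OF a(1,2)] this]
    show "E z (u z) (\<phi>x z) (\<phi>t z) \<le> 0" using eq[OF a(2)] by simp
  qed
  show "viscosity_supersolution E W u"
    unfolding viscosity_supersolution_def
  proof (intro allI impI ballI)
    fix \<phi> \<phi>x \<phi>t z
    assume a: "C1_with_partials W \<phi> \<phi>x \<phi>t" "z \<in> W" "\<forall>\<^sub>F w in nhds z. u w - \<phi> w \<ge> u z - \<phi> z"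
    from local_min_has_derivative_zero[OF d(1)[OF a(1,2)] a(3)]
    show "0 \<le> E z (u z) (\<phi>x z) (\<phi>t z)" using eq[OF a(2)] by simp
  qed
qed

text \<open>The maximum principle in the form needed for both comparisons.\<close>
lemma quadrant_interior_max:
  fixes W :: "real \<times> real \<Rightarrow> real"
  assumes cont: "continuous_on ({0..} \<times> {0..}) W"
    and far: "\<And>x t. 0 \<le> x \<Longrightarrow> 0 \<le> t \<Longrightarrow> R < x \<or> R < t \<Longrightarrow> W (x, t) \<le> 0"
    and bdry: "\<And>x t. 0 \<le> x \<Longrightarrow> 0 \<le> t \<Longrightarrow> x = 0 \<or> t = 0 \<Longrightarrow> W (x, t) \<le> 0"
    and pos: "0 \<le> x1" "0 \<le> t1" "W (x1, t1) > 0"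
  obtains x t where "0 < x" "0 < t" "W (x, t) > 0" "\<forall>\<^sub>F w in nhds (x, t). W w \<le> W (x, t)"
proof -
  let ?B = "{0..R} \<times> {0..R}"
  have in_B: "(x, t) \<in> ?B" if "0 \<le> x" "0 \<le> t" "W (x, t) > 0" for x t
    using far[of x t] that by force
  have "compact ?B" "?B \<noteq> {}" using in_B[OF pos] by (auto intro: compact_Times)
  moreover have "continuous_on ?B W" by (rule continuous_on_subset[OF cont]) auto
  ultimately obtain z where z: "z \<in> ?B" "\<forall>w\<in>?B. W w \<le> W z"
    using continuous_attains_sup[of ?B W] by blast
  obtain x t where zxt: "z = (x, t)" by (cases z)
  have Wz: "W z > 0" using z(2) in_B[OF pos] pos(3) by force
  have x: "0 < x" "0 < t"
    using z(1) Wz bdry[of x t] unfolding zxt by (auto simp: less_le)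
  have max: "W w \<le> W z" if "w \<in> {0<..} \<times> {0<..}" for w
  proof (cases "W w > 0")
    case True
    then have "w \<in> ?B" using in_B[of "fst w" "snd w"] that by (simp add: mem_Times_iff)
    then show ?thesis using z(2) by blast
  qed (use Wz in simp)
  have "\<forall>\<^sub>F w in nhds z. w \<in> {0<..} \<times> {0<..}"
    by (rule eventually_nhds_in_open) (use x in \<open>auto simp: zxt open_Times\<close>)
  then have "\<forall>\<^sub>F w in nhds z. W w \<le> W z" by eventually_elim (rule max)
  then show thesis using that[of x t] x Wz unfolding zxt by blast
qed

locale classical_solution =
  fixes F Fx Ft :: "real \<times> real \<Rightarrow> real" and K :: real
  assumes cont: "continuous_on ({0..} \<times> {0..}) F"
    and C1: "C1_with_partials ({0<..} \<times> {0<..}) F Fx Ft"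
    and eq: "\<And>z. z \<in> {0<..} \<times> {0<..} \<Longrightarrow> cf_operator z (F z) (Fx z) (Ft z) = 0"
    and Fx_nonneg: "\<And>z. z \<in> {0<..} \<times> {0<..} \<Longrightarrow> 0 \<le> Fx z"
    and between: "\<And>x t. 0 \<le> x \<Longrightarrow> 0 \<le> t \<Longrightarrow> 0 \<le> F (x, t) \<and> F (x, t) \<le> x"
    and growth: "\<And>x t. 0 \<le> x \<Longrightarrow> 0 \<le> t \<Longrightarrow> F (x, t) ^ 3 \<le> K * x\<^sup>2"
begin

text \<open>The penalties depend on \<open>x + 2 t\<close> only: the transport speed is at most \<open>3/2\<close> for nonnegative slopes, so
  a front of speed 2 moves ahead of it and the penalty has a strict sign in the equation.\<close>
lemma C1_perturbed:
  assumes "\<And>s. (h has_field_derivative h' s) (at s)" "continuous_on UNIV h'"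
  shows "C1_with_partials ({0<..} \<times> {0<..}) (\<lambda>z. F z + h (fst z + 2 * snd z))
     (\<lambda>z. Fx z + h' (fst z + 2 * snd z)) (\<lambda>z. Ft z + 2 * h' (fst z + 2 * snd z))"
  unfolding C1_with_partials_def
proof (intro conjI ballI)
  have c: "continuous_on A (\<lambda>z. h' (fst z + 2 * snd z))" for A :: "(real \<times> real) set"
    by (rule continuous_on_compose2[OF assms(2)]) (auto intro!: continuous_intros)
  show "continuous_on ({0<..} \<times> {0<..}) (\<lambda>z. Fx z + h' (fst z + 2 * snd z))"
    "continuous_on ({0<..} \<times> {0<..}) (\<lambda>z. Ft z + 2 * h' (fst z + 2 * snd z))"
    using C1 by (auto simp: C1_with_partials_def intro!: continuous_intros c)
  fix z :: "real \<times> real" assume "z \<in> {0<..} \<times> {0<..}"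
  then have F: "(F has_derivative (\<lambda>(h, k). Fx z * h + Ft z * k)) (at z)"
    using C1 by (auto simp: C1_with_partials_def)
  have "((\<lambda>z. fst z + 2 * snd z) has_derivative (\<lambda>k. fst k + 2 * snd k)) (at z)"
    by (auto intro!: derivative_eq_intros)
  from has_derivative_compose[OF this assms(1)[unfolded has_field_derivative_def]]
  have "((\<lambda>z. h (fst z + 2 * snd z)) has_derivative (\<lambda>k. h' (fst z + 2 * snd z) * (fst k + 2 * snd k))) (at z)" .
  from has_derivative_add[OF F this]
  show "((\<lambda>z. F z + h (fst z + 2 * snd z)) has_derivative
       (\<lambda>(h, k). (Fx z + h' (fst z + 2 * snd z)) * h + (Ft z + 2 * h' (fst z + 2 * snd z)) * k)) (at z)"
    by (rule has_derivative_eq_rhs) (auto simp: algebra_simps)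
qed

text \<open>The quadratic penalty dominates \<open>G \<le> x\<close> at infinity. Its slope may be large, but the
  resulting square enters the equation with the sign that helps.\<close>
lemma subsolution_le:
  assumes G: "continuous_on ({0..} \<times> {0..}) G" "viscosity_subsolution cf_operator ({0<..} \<times> {0<..}) G"
    and between_G: "\<And>x t. 0 \<le> x \<Longrightarrow> 0 \<le> t \<Longrightarrow> 0 \<le> G (x, t) \<and> G (x, t) \<le> x"
    and init: "\<And>x. 0 \<le> x \<Longrightarrow> G (x, 0) \<le> F (x, 0)"
    and xt: "0 \<le> x1" "0 \<le> t1"
  shows "G (x1, t1) \<le> F (x1, t1)"
proof (rule ccontr)
  assume neg: "\<not> ?thesis"
  define m where "m = G (x1, t1) - F (x1, t1)"
  have m: "m > 0" using neg by (simp add: m_def)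
  define s1 where "s1 = (x1 + 2 * t1)\<^sup>2"
  define \<epsilon> where "\<epsilon> = m / (2 * (s1 + 1))"
  have s1: "s1 \<ge> 0" by (simp add: s1_def)
  then have \<epsilon>: "\<epsilon> > 0" using m by (simp add: \<epsilon>_def)
  have "\<epsilon> * (s1 + 1) = m / 2" using s1 by (simp add: \<epsilon>_def field_simps)
  then have small: "\<epsilon> * s1 < m" using m \<epsilon> by (simp add: algebra_simps)
  define W where "W z = G z - F z - \<epsilon> * (fst z + 2 * snd z)\<^sup>2" for z
  define R where "R = 1 / \<epsilon>"
  obtain x t where z: "0 < x" "0 < t" "W (x, t) > 0" "\<forall>\<^sub>F w in nhds (x, t). W w \<le> W (x, t)"
  proof (rule quadrant_interior_max[of W R x1 t1])
    show "continuous_on ({0..} \<times> {0..}) W" unfolding W_def by (intro continuous_intros G cont)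
    show "W (x, t) \<le> 0" if "0 \<le> x" "0 \<le> t" "R < x \<or> R < t" for x t
    proof -
      have "1 / \<epsilon> \<le> x + 2 * t" using that by (auto simp: R_def)
      then have "1 \<le> \<epsilon> * (x + 2 * t)" using \<epsilon> by (simp add: field_simps)
      then have "x * 1 \<le> (x + 2 * t) * (\<epsilon> * (x + 2 * t))" using that by (intro mult_mono) auto
      then show ?thesis using between[OF that(1,2)] between_G[OF that(1,2)] unfolding W_def
        by (simp add: power2_eq_square algebra_simps)
    qed
    show "W (x, t) \<le> 0" if "0 \<le> x" "0 \<le> t" "x = 0 \<or> t = 0" for x t
    proof -
      have "G (x, t) \<le> F (x, t)"
        using that(3) init[OF that(1)] between[OF that(1,2)] between_G[OF that(1,2)] by auto
      moreover have "0 \<le> \<epsilon> * (x + 2 * t)\<^sup>2" using \<epsilon> by simp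
      ultimately show ?thesis unfolding W_def by simp
    qed
    show "0 < W (x1, t1)" using small unfolding W_def m_def s1_def by simp
  qed (use xt in auto)
  have zU: "(x, t) \<in> {0<..} \<times> {0<..}" using z by auto
  have GF: "G (x, t) > F (x, t)"
  proof -
    have "0 \<le> \<epsilon> * (x + 2 * t)\<^sup>2" using \<epsilon> by simp
    then show ?thesis using z(3) unfolding W_def by simp
  qed
  define e where "e = \<epsilon> * (2 * (x + 2 * t))"
  have e: "e > 0" using \<epsilon> z by (simp add: e_def)
  have "((\<lambda>s. \<epsilon> * s\<^sup>2) has_field_derivative \<epsilon> * (2 * s)) (at s)" for s
    by (auto intro!: derivative_eq_intros)
  moreover have "continuous_on UNIV (\<lambda>s. \<epsilon> * (2 * s))" by (intro continuous_intros)
  ultimately have test: "C1_with_partials ({0<..} \<times> {0<..}) (\<lambda>z. F z + \<epsilon> * (fst z + 2 * snd z)\<^sup>2)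
     (\<lambda>z. Fx z + \<epsilon> * (2 * (fst z + 2 * snd z))) (\<lambda>z. Ft z + 2 * (\<epsilon> * (2 * (fst z + 2 * snd z))))"
    by (rule C1_perturbed)
  have "\<forall>\<^sub>F w in nhds (x, t). G w - (F w + \<epsilon> * (fst w + 2 * snd w)\<^sup>2)
      \<le> G (x, t) - (F (x, t) + \<epsilon> * (fst (x, t) + 2 * snd (x, t))\<^sup>2)"
    using z(4) unfolding W_def by eventually_elim (simp add: algebra_simps)
  then have "cf_operator (x, t) (G (x, t)) (Fx (x, t) + e) (Ft (x, t) + 2 * e) \<le> 0"
    using G(2)[unfolded viscosity_subsolution_def, rule_format, OF test zU] by (simp add: e_def)
  then have "cf_operator (x, t) (G (x, t)) (Fx (x, t) + e) (Ft (x, t) + 2 * e)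
     - cf_operator (x, t) (F (x, t)) (Fx (x, t)) (Ft (x, t)) \<le> 0"
    using eq[OF zU] by simp
  moreover have "cf_operator (x, t) (G (x, t)) (Fx (x, t) + e) (Ft (x, t) + 2 * e)
     - cf_operator (x, t) (F (x, t)) (Fx (x, t)) (Ft (x, t))
     = e / 2 + e * Fx (x, t) + e * e / 2 + (G (x, t) - F (x, t)) / x"
    using z(1) unfolding cf_operator_def by (simp add: field_simps)
  moreover have "0 \<le> e * Fx (x, t)" "0 < e * e" "0 < (G (x, t) - F (x, t)) / x"
    using e Fx_nonneg[OF zU] GF z by auto
  ultimately show False using e by linarith
qed

text \<open>Here the square of the slope of the penalty has the wrong sign, so the penalty must be linear with
  a small factor. It still dominates at infinity, because \<open>F\<close> is sublinear uniformly in time.\<close>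
lemma supersolution_ge:
  assumes G: "continuous_on ({0..} \<times> {0..}) G" "viscosity_supersolution cf_operator ({0<..} \<times> {0<..}) G"
    and between_G: "\<And>x t. 0 \<le> x \<Longrightarrow> 0 \<le> t \<Longrightarrow> 0 \<le> G (x, t) \<and> G (x, t) \<le> x"
    and init: "\<And>x. 0 \<le> x \<Longrightarrow> F (x, 0) \<le> G (x, 0)"
    and xt: "0 \<le> x1" "0 \<le> t1"
  shows "F (x1, t1) \<le> G (x1, t1)"
proof (rule ccontr)
  assume neg: "\<not> ?thesis"
  define m where "m = F (x1, t1) - G (x1, t1)"
  have m: "m > 0" using neg by (simp add: m_def)
  define s1 where "s1 = x1 + 2 * t1"
  define \<epsilon> where "\<epsilon> = min (1 / 2) (m / (2 * (s1 + 1)))"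
  have s1: "s1 \<ge> 0" using xt by (simp add: s1_def)
  then have \<epsilon>: "\<epsilon> > 0" "\<epsilon> < 1" using m by (auto simp: \<epsilon>_def)
  have "\<epsilon> * (s1 + 1) \<le> m / (2 * (s1 + 1)) * (s1 + 1)" using s1 by (intro mult_right_mono) (auto simp: \<epsilon>_def)
  also have "\<dots> = m / 2" using s1 by (simp add: field_simps)
  finally have small: "\<epsilon> * s1 < m" using m \<epsilon> by (simp add: algebra_simps)
  define W where "W z = F z - G z - \<epsilon> * (fst z + 2 * snd z)" for z
  (* Beyond R the growth bound gives F ^ 3 \<le> (\<epsilon> (x + 2 t)) ^ 3. *)
  define R where "R = \<bar>K\<bar> / \<epsilon> ^ 3"
  obtain x t where z: "0 < x" "0 < t" "W (x, t) > 0" "\<forall>\<^sub>F w in nhds (x, t). W w \<le> W (x, t)"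
  proof (rule quadrant_interior_max[of W R x1 t1])
    show "continuous_on ({0..} \<times> {0..}) W" unfolding W_def by (intro continuous_intros G cont)
    show "W (x, t) \<le> 0" if "0 \<le> x" "0 \<le> t" "R < x \<or> R < t" for x t
    proof -
      have "R < x + 2 * t" using that by auto
      then have R: "\<bar>K\<bar> \<le> (x + 2 * t) * \<epsilon> ^ 3" using \<epsilon> by (simp add: R_def field_simps)
      have "F (x, t) ^ 3 \<le> \<bar>K\<bar> * x\<^sup>2"
        by (rule order_trans[OF growth[OF that(1,2)]]) (auto intro!: mult_right_mono)
      also have "\<dots> \<le> ((x + 2 * t) * \<epsilon> ^ 3) * (x + 2 * t)\<^sup>2"
        using R that by (intro mult_mono power_mono) auto
      also have "\<dots> = (\<epsilon> * (x + 2 * t)) ^ 3" by (simp add: power2_eq_square power3_eq_cube)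
      finally have "F (x, t) \<le> \<epsilon> * (x + 2 * t)"
        by (rule power_le_imp_le_base[of _ 2, unfolded Suc_eq_plus1, simplified]) (use \<epsilon> that in auto)
      then show ?thesis using between_G[OF that(1,2)] unfolding W_def by simp
    qed
    show "W (x, t) \<le> 0" if "0 \<le> x" "0 \<le> t" "x = 0 \<or> t = 0" for x t
    proof -
      have "F (x, t) \<le> G (x, t)"
        using that(3) init[OF that(1)] between[OF that(1,2)] between_G[OF that(1,2)] by auto
      moreover have "0 \<le> \<epsilon> * (x + 2 * t)" using \<epsilon> that by simp
      ultimately show ?thesis unfolding W_def by simp
    qed
    show "0 < W (x1, t1)" using small unfolding W_def m_def s1_def by simp
  qed (use xt in auto)
  have zU: "(x, t) \<in> {0<..} \<times> {0<..}" using z by auto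
  have GF: "G (x, t) < F (x, t)"
  proof -
    have "0 \<le> \<epsilon> * (x + 2 * t)" using \<epsilon> z by simp
    then show ?thesis using z(3) unfolding W_def by simp
  qed
  have "((\<lambda>s. - \<epsilon> * s) has_field_derivative - \<epsilon>) (at s)" for s
    by (auto intro!: derivative_eq_intros)
  moreover have "continuous_on UNIV (\<lambda>s::real. - \<epsilon>)" by (intro continuous_intros)
  ultimately have test: "C1_with_partials ({0<..} \<times> {0<..}) (\<lambda>z. F z + - \<epsilon> * (fst z + 2 * snd z))
     (\<lambda>z. Fx z + - \<epsilon>) (\<lambda>z. Ft z + 2 * - \<epsilon>)"
    by (rule C1_perturbed)
  have "\<forall>\<^sub>F w in nhds (x, t). G w - (F w + - \<epsilon> * (fst w + 2 * snd w))
      \<ge> G (x, t) - (F (x, t) + - \<epsilon> * (fst (x, t) + 2 * snd (x, t)))"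
    using z(4) unfolding W_def by eventually_elim (simp add: algebra_simps)
  then have "0 \<le> cf_operator (x, t) (G (x, t)) (Fx (x, t) + - \<epsilon>) (Ft (x, t) + 2 * - \<epsilon>)"
    by (rule G(2)[unfolded viscosity_supersolution_def, rule_format, OF test zU])
  then have "0 \<le> cf_operator (x, t) (G (x, t)) (Fx (x, t) + - \<epsilon>) (Ft (x, t) + 2 * - \<epsilon>)
     - cf_operator (x, t) (F (x, t)) (Fx (x, t)) (Ft (x, t))"
    using eq[OF zU] by simp
  moreover have "cf_operator (x, t) (G (x, t)) (Fx (x, t) + - \<epsilon>) (Ft (x, t) + 2 * - \<epsilon>)
     - cf_operator (x, t) (F (x, t)) (Fx (x, t)) (Ft (x, t))
     = - \<epsilon> / 2 - \<epsilon> * Fx (x, t) + \<epsilon> * \<epsilon> / 2 - (F (x, t) - G (x, t)) / x"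
    using z(1) unfolding cf_operator_def by (simp add: field_simps)
  moreover have "0 \<le> \<epsilon> * Fx (x, t)" "\<epsilon> * \<epsilon> \<le> \<epsilon> * 1" "0 < (F (x, t) - G (x, t)) / x"
    using \<epsilon> Fx_nonneg[OF zU] GF z by (auto intro: mult_left_mono)
  ultimately show False by linarith
qed

lemma sublinear_F:
  assumes "0 \<le> t"
  shows "sublinear (\<lambda>x. F (x, t))"
  unfolding sublinear_def
proof (rule tendsto_sandwich)
  show "\<forall>\<^sub>F x in at_top. 0 \<le> F (x, t) / x"
    using eventually_gt_at_top[of 0] by eventually_elim (use between assms in simp)
  show "\<forall>\<^sub>F x in at_top. F (x, t) / x \<le> root 3 (K / x)"
    using eventually_gt_at_top[of 0]
  proof eventually_elim
    case (elim x)
    have "(F (x, t) / x) ^ 3 \<le> K * x\<^sup>2 / x ^ 3"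
      unfolding power_divide using growth[of x t] elim assms by (intro divide_right_mono) auto
    also have "\<dots> = K / x" using elim by (simp add: power2_eq_square power3_eq_cube)
    finally have "root 3 ((F (x, t) / x) ^ 3) \<le> root 3 (K / x)" by simp
    then show ?case by (simp add: odd_real_root_power_cancel)
  qed
  have "((\<lambda>x. K / x) \<longlongrightarrow> 0) at_top"
    by (rule tendsto_divide_0[OF tendsto_const filterlim_at_top_imp_at_infinity[OF filterlim_ident]])
  from tendsto_real_root[OF this, of 3] show "((\<lambda>x. root 3 (K / x)) \<longlongrightarrow> 0) at_top" by simp
qed simp

lemma cf_solution_unique:
  "cf_solution (\<lambda>x. F (x, 0)) F"
  "cf_solution (\<lambda>x. F (x, 0)) G \<Longrightarrow> 0 \<le> x \<Longrightarrow> 0 \<le> t \<Longrightarrow> G (x, t) = F (x, t)"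
proof -
  show "cf_solution (\<lambda>x. F (x, 0)) F"
    unfolding cf_solution_def using cont sublinear_F between
      classical_solution_is_viscosity_solution[of _ _ _ _ cf_operator, OF C1 eq] by blast
  assume G: "cf_solution (\<lambda>x. F (x, 0)) G" and xt: "0 \<le> x" "0 \<le> t"
  note G' = G[unfolded cf_solution_def]
  have "G (x, t) \<le> F (x, t)" by (rule subsolution_le) (use G' xt in auto)
  moreover have "F (x, t) \<le> G (x, t)" by (rule supersolution_ge) (use G' xt in auto)
  ultimately show "G (x, t) = F (x, t)" by simp
qed

end

section \<open>The solution of the initial value problem\<close>

text \<open>The time is shifted by 2, so that the closed quadrant lies inside the region \<open>t > 1\<close> of \<open>sol\<close>
  and the initial datum is differentiable for \<open>x > 0\<close>.\<close>
definition cf_sol :: "real \<times> real \<Rightarrow> real" where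
  "cf_sol z = (if 0 < fst z then sol (fst z, snd z + 2) else 0)"
definition cf_sol_x :: "real \<times> real \<Rightarrow> real" where "cf_sol_x z = sol_x (fst z, snd z + 2)"
definition cf_sol_t :: "real \<times> real \<Rightarrow> real" where "cf_sol_t z = sol_t (fst z, snd z + 2)"

lemma cf_sol_has_derivative:
  assumes "0 < fst z" "-1 < snd z"
  shows "(cf_sol has_derivative (\<lambda>h. cf_sol_x z * fst h + cf_sol_t z * snd h)) (at z)"
proof -
  have s: "((\<lambda>z. (fst z, snd z + 2)) has_derivative (\<lambda>h. (fst h, snd h))) (at z)"
    by (auto intro!: derivative_eq_intros)
  have "((\<lambda>z. sol (fst z, snd z + 2)) has_derivative (\<lambda>h. cf_sol_x z * fst h + cf_sol_t z * snd h)) (at z)"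
    using has_derivative_compose[OF s sol_has_derivative[of "(fst z, snd z + 2)"]] assms
    unfolding cf_sol_x_def cf_sol_t_def by simp
  then show ?thesis
  proof (rule has_derivative_transform_within_open)
    show "open {z::real \<times> real. 0 < fst z}" by (intro open_Collect_less continuous_intros)
  qed (use assms in \<open>auto simp: cf_sol_def\<close>)
qed

lemma cf_sol_continuous: "continuous_on ({0..} \<times> {0..}) cf_sol"
proof (rule continuous_on_eq_continuous_within[THEN iffD2], rule ballI)
  fix z :: "real \<times> real" assume z: "z \<in> {0..} \<times> {0..}"
  show "continuous (at z within {0..} \<times> {0..}) cf_sol"
  proof (cases "0 < fst z")
    case True
    then have "isCont cf_sol z" using has_derivative_continuous[OF cf_sol_has_derivative[of z]] z by auto
    then show ?thesis by (rule continuous_at_imp_continuous_within)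
  next
    case False
    have "((\<lambda>w. cf_sol w) \<longlongrightarrow> 0) (at z within {0..} \<times> {0..})"
    proof (rule tendsto_sandwich[OF _ _ tendsto_const])
      have ev: "\<forall>\<^sub>F w in at z within {0..} \<times> {0..}. w \<in> {0..} \<times> {0..}"
        by (simp add: eventually_at_filter)
      show "\<forall>\<^sub>F w in at z within {0..} \<times> {0..}. 0 \<le> cf_sol w"
        using ev by eventually_elim (auto simp: cf_sol_def intro!: sol_properties(2))
      show "\<forall>\<^sub>F w in at z within {0..} \<times> {0..}. cf_sol w \<le> fst w"
        using ev by eventually_elim (auto simp: cf_sol_def intro!: sol_properties(3))
      have "(fst \<longlongrightarrow> fst z) (at z within {0..} \<times> {0..})" by (intro tendsto_intros)
      then show "(fst \<longlongrightarrow> 0) (at z within {0..} \<times> {0..})" using False z by auto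
    qed
    moreover have "cf_sol z = 0" using False by (simp add: cf_sol_def)
    ultimately show ?thesis by (simp add: continuous_within)
  qed
qed

interpretation classical_solution cf_sol cf_sol_x cf_sol_t 540000
proof
  show "continuous_on ({0..} \<times> {0..}) cf_sol" by (rule cf_sol_continuous)
  show "C1_with_partials ({0<..} \<times> {0<..}) cf_sol cf_sol_x cf_sol_t"
    unfolding C1_with_partials_def
  proof (intro conjI ballI)
    have c: "continuous_on ({0<..} \<times> {0<..}) (\<lambda>z::real \<times> real. (fst z, snd z + 2 :: real))"
      by (intro continuous_intros)
    show "continuous_on ({0<..} \<times> {0<..}) cf_sol_x" unfolding cf_sol_x_def[abs_def]
      by (rule continuous_on_compose2[OF sol_partials_continuous(1) c]) auto
    show "continuous_on ({0<..} \<times> {0<..}) cf_sol_t" unfolding cf_sol_t_def[abs_def]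
      by (rule continuous_on_compose2[OF sol_partials_continuous(2) c]) auto
    fix z :: "real \<times> real" assume "z \<in> {0<..} \<times> {0<..}"
    then show "(cf_sol has_derivative (\<lambda>(h, k). cf_sol_x z * h + cf_sol_t z * k)) (at z)"
      using cf_sol_has_derivative[of z] by (simp add: case_prod_beta' mem_Times_iff)
  qed
  show "cf_operator z (cf_sol z) (cf_sol_x z) (cf_sol_t z) = 0" if "z \<in> {0<..} \<times> {0<..}" for z
    using that sol_properties(1)[of "fst z" "snd z + 2" "snd z"]
    by (auto simp: cf_sol_def cf_sol_x_def cf_sol_t_def)
  show "0 \<le> cf_sol_x z" if "z \<in> {0<..} \<times> {0<..}" for z
    using that by (auto simp: cf_sol_x_def intro!: sol_properties(4))
  show "0 \<le> cf_sol (x, t) \<and> cf_sol (x, t) \<le> x" if "0 \<le> x" "0 \<le> t" for x t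
    using that sol_properties(2,3)[of x "t + 2"] by (auto simp: cf_sol_def)
  show "cf_sol (x, t) ^ 3 \<le> 540000 * x\<^sup>2" if "0 \<le> x" "0 \<le> t" for x t
    using that sol_properties(6)[of x "t + 2"] by (auto simp: cf_sol_def)
qed

lemma cf_sol_0_deriv:
  assumes "0 < x"
  shows "((\<lambda>x. cf_sol (x, 0)) has_field_derivative cf_sol_x (x, 0)) (at x)" "0 \<le> cf_sol_x (x, 0)" "cf_sol_x (x, 0) \<le> 1"
proof -
  show "((\<lambda>x. cf_sol (x, 0)) has_field_derivative cf_sol_x (x, 0)) (at x)"
    using partials_from_has_derivative(1)[OF cf_sol_has_derivative[of "(x, 0)"]] assms by simp
  show "0 \<le> cf_sol_x (x, 0)" "cf_sol_x (x, 0) \<le> 1"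
    using sol_properties(4,5)[of x 2] assms by (auto simp: cf_sol_x_def)
qed

lemma cf_sol_0_lipschitz: "1-lipschitz_on {0..} (\<lambda>x. cf_sol (x, 0))"
proof (rule lipschitz_onI)
  have le: "\<bar>cf_sol (y, 0) - cf_sol (x, 0)\<bar> \<le> y - x" if "0 \<le> x" "x < y" for x y
  proof (cases "x = 0")
    case True
    then show ?thesis using between[of y 0] between[of 0 0] that by auto
  next
    case False
    obtain c where "x < c" "c < y" "cf_sol (y, 0) - cf_sol (x, 0) = (y - x) * cf_sol_x (c, 0)"
      using MVT2[OF \<open>x < y\<close>, of "\<lambda>x. cf_sol (x, 0)" "\<lambda>x. cf_sol_x (x, 0)"] cf_sol_0_deriv(1) \<open>0 \<le> x\<close> False by force
    moreover have "\<bar>(y - x) * cf_sol_x (c, 0)\<bar> \<le> (y - x) * 1"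
      using cf_sol_0_deriv(2,3)[of c] calculation that False by (intro abs_mult_le) auto
    ultimately show ?thesis by simp
  qed
  fix x y :: real assume "x \<in> {0..}" "y \<in> {0..}"
  then show "dist (cf_sol (x, 0)) (cf_sol (y, 0)) \<le> 1 * dist x y"
    using le[of x y] le[of y x] by (cases x y rule: linorder_cases) (auto simp: dist_real_def abs_minus_commute)
qed simp

section \<open>Oscillation of the initial datum\<close>

lemma sin_ln_extremal:
  fixes B :: real
  shows "\<exists>\<tau>\<ge>B. sin (ln \<tau>) = 1" "\<exists>\<tau>\<ge>B. sin (ln \<tau>) = - 1"
proof -
  obtain n :: nat where n: "max 1 B \<le> real n" using real_arch_simple by blast
  have ge: "B \<le> exp (c + 2 * real n * pi)" if "- 2 \<le> c" for c
  proof -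
    have "2 * real n * 3 \<le> 2 * real n * pi" using pi_gt3 by (intro mult_left_mono) auto
    then show ?thesis using exp_ge_add_one_self[of "c + 2 * real n * pi"] n that by linarith
  qed
  have "sin (ln (exp (pi / 2 + 2 * real n * pi))) = 1" "sin (ln (exp (- (pi / 2) + 2 * real n * pi))) = - 1"
    by (simp_all add: sin_add sin_diff)
  moreover have "- 2 \<le> pi / 2" "- 2 \<le> - (pi / 2)" using pi_less_4 pi_gt3 by auto
  ultimately show "\<exists>\<tau>\<ge>B. sin (ln \<tau>) = 1" "\<exists>\<tau>\<ge>B. sin (ln \<tau>) = - 1" using ge by blast+
qed

lemma char_value_expand:
  assumes "z \<in> char_dom"
  shows "\<bar>char_value z - 3 / 2 * amp (snd z) * (fst z)\<^sup>2\<bar> \<le> 10 * fst z"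
    "\<bar>osc_sq z - (fst z)\<^sup>2\<bar> \<le> 10 * (1 + fst z)" "1 \<le> amp (snd z)" "amp (snd z) \<le> 3"
proof -
  interpret char_domain_t "fst z" "snd z" "amp (snd z)" "freq (snd z)" "amp' (snd z)" "freq' (snd z)"
    by (rule char_dom_is_char_domain[OF assms])
  let ?g = "amp (snd z)" and ?a = "fst z"
  show g: "1 \<le> ?g" "?g \<le> 3" by (rule g)+
  have "\<bar>?a * (?g\<^sup>2 + expansion_rest / 2)\<bar> \<le> ?a * 10"
  proof (rule abs_mult_le)
    have "10000 * slow = 1 / 100" by (simp add: slow_def)
    then show "\<bar>?g\<^sup>2 + expansion_rest / 2\<bar> \<le> 10" using g_sq(2) expansion_rest_le unfolding abs_le_iff by argo
  qed (use a0 in simp)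
  moreover have "char_value z - 3 / 2 * ?g * ?a\<^sup>2 = ?a * (?g\<^sup>2 + expansion_rest / 2)"
    unfolding char_value_def uval_expand by (simp add: algebra_simps power2_eq_square)
  ultimately show "\<bar>char_value z - 3 / 2 * ?g * ?a\<^sup>2\<bar> \<le> 10 * ?a" by simp
  have "?g * ?a \<le> 3 * ?a" "0 \<le> ?g * ?a" using g a0 by (auto intro: mult_right_mono)
  moreover have "(?g + ?a)\<^sup>2 = ?g\<^sup>2 + 2 * (?g * ?a) + ?a\<^sup>2" by (simp add: power2_eq_square algebra_simps)
  moreover have "3000 * slow * (1 + ?a) = 3 / 1000 + 3 / 1000 * ?a" by (simp add: slow_def algebra_simps)
  ultimately show "\<bar>osc_sq z - ?a\<^sup>2\<bar> \<le> 10 * (1 + ?a)"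
    using ysq_err g_sq(2) a0 unfolding osc_sq_def[symmetric] abs_le_iff by argo
qed

text \<open>With \<open>x = a * osc_sq\<close> and both \<open>osc_sq / a\<^sup>2\<close> tending to 1 and \<open>F / a\<^sup>2 - 3 g / 2\<close> tending to 0, the ratio
  approaches \<open>3 g / 2\<close>, where \<open>g\<close> belongs to the characteristic starting at \<open>x\<close>.\<close>
lemma far_field:
  "((\<lambda>x. cf_sol (x, 0) / x powr (2 / 3) - 3 / 2 * amp (snd (char_coord (x, 2)))) \<longlongrightarrow> 0) at_top"
proof -
  define A where "A x = fst (char_coord (x, 2))" for x :: real
  define g where "g x = amp (snd (char_coord (x, 2)))" for x :: real
  define q where "q x = osc_sq (char_coord (x, 2)) / (A x)\<^sup>2" for x
  have c: "char_coord (x, 2) \<in> char_dom" "char_place (char_coord (x, 2)) = x" "0 < A x" if "0 < x" for x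
    using char_coord[of "(x, 2)"] that char_dom_int_subset by (auto simp: char_param_def A_def char_dom_int_def)
  have A: "filterlim A at_top at_top"
    unfolding filterlim_at_top_gt[where c = 0]
  proof (intro allI impI)
    fix M :: real assume M: "0 < M"
    show "\<forall>\<^sub>F x in at_top. M \<le> A x"
      using eventually_gt_at_top[of "20 * M * (1 + M)\<^sup>2"]
    proof eventually_elim
      case (elim x)
      then have x: "0 < x" using M by (intro le_less_trans[OF _ elim]) auto
      have "x = A x * osc_sq (char_coord (x, 2))" using c(2)[OF x] by (simp add: char_place_def A_def)
      also have "\<dots> \<le> A x * (20 * (1 + A x)\<^sup>2)"
        using char_dom_bounds(2)[OF c(1)[OF x]] c(3)[OF x] by (intro mult_left_mono) (auto simp: A_def)
      finally have x': "x \<le> 20 * A x * (1 + A x)\<^sup>2" by simp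
      show ?case
      proof (rule ccontr)
        assume "\<not> M \<le> A x"
        then have "20 * A x * (1 + A x)\<^sup>2 \<le> 20 * M * (1 + M)\<^sup>2"
          using c(3)[OF x] by (intro mult_mono power_mono) auto
        then show False using x' elim by simp
      qed
    qed
  qed
  have Ainv: "((\<lambda>x. 1 / A x) \<longlongrightarrow> 0) at_top"
    by (rule tendsto_divide_0[OF tendsto_const filterlim_at_top_imp_at_infinity[OF A]])
  have pos: "\<forall>\<^sub>F x::real in at_top. 0 < x" by (rule eventually_gt_at_top)
  have "((\<lambda>x. q x - 1) \<longlongrightarrow> 0) at_top"
  proof (rule Lim_null_comparison)
    show "\<forall>\<^sub>F x in at_top. norm (q x - 1) \<le> 10 * (1 / A x * (1 / A x) + 1 / A x)"
      using pos
    proof eventually_elim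
      case (elim x)
      have "q x - 1 = (osc_sq (char_coord (x, 2)) - (A x)\<^sup>2) / (A x)\<^sup>2"
        using c(3)[OF elim] by (simp add: q_def diff_divide_distrib)
      also have "norm \<dots> \<le> 10 * (1 + A x) / (A x)\<^sup>2"
        using char_value_expand(2)[OF c(1)[OF elim]] by (simp add: A_def divide_right_mono)
      also have "\<dots> = 10 * (1 / A x * (1 / A x) + 1 / A x)"
        using c(3)[OF elim] by (simp add: field_simps power2_eq_square)
      finally show ?case .
    qed
    show "((\<lambda>x. 10 * (1 / A x * (1 / A x) + 1 / A x)) \<longlongrightarrow> 0) at_top"
      using tendsto_mult[OF tendsto_const[of 10] tendsto_add[OF tendsto_mult[OF Ainv Ainv] Ainv]] by simp
  qed
  then have "(q \<longlongrightarrow> 1) at_top" by (rule LIM_zero_cancel)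
  then have q: "((\<lambda>x. q x powr (- 2 / 3)) \<longlongrightarrow> 1) at_top"
    using tendsto_powr[of q 1 at_top "\<lambda>_. - 2 / 3" "- 2 / 3"] by simp
  have e: "((\<lambda>x. char_value (char_coord (x, 2)) / (A x)\<^sup>2 - 3 / 2 * g x) \<longlongrightarrow> 0) at_top"
  proof (rule Lim_null_comparison)
    show "\<forall>\<^sub>F x in at_top. norm (char_value (char_coord (x, 2)) / (A x)\<^sup>2 - 3 / 2 * g x) \<le> 10 * (1 / A x)"
      using pos
    proof eventually_elim
      case (elim x)
      have "char_value (char_coord (x, 2)) / (A x)\<^sup>2 - 3 / 2 * g x = (char_value (char_coord (x, 2)) - 3 / 2 * g x * (A x)\<^sup>2) / (A x)\<^sup>2"
        using c(3)[OF elim] by (simp add: diff_divide_distrib)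
      also have "norm \<dots> \<le> 10 * A x / (A x)\<^sup>2"
        using char_value_expand(1)[OF c(1)[OF elim]] by (simp add: A_def g_def divide_right_mono)
      also have "\<dots> = 10 * (1 / A x)"
        using c(3)[OF elim] by (simp add: field_simps power2_eq_square)
      finally show ?case .
    qed
    show "((\<lambda>x. 10 * (1 / A x)) \<longlongrightarrow> 0) at_top"
      using tendsto_mult[OF tendsto_const[of 10] Ainv] by simp
  qed
  have "((\<lambda>x. 3 / 2 * g x * (q x powr (- 2 / 3) - 1)) \<longlongrightarrow> 0) at_top"
  proof (rule Lim_null_comparison)
    show "\<forall>\<^sub>F x in at_top. norm (3 / 2 * g x * (q x powr (- 2 / 3) - 1)) \<le> 9 / 2 * \<bar>q x powr (- 2 / 3) - 1\<bar>"
      using pos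
    proof eventually_elim
      case (elim x)
      then show ?case using char_value_expand(3,4)[OF c(1)[OF elim]] unfolding real_norm_def g_def
        by (intro abs_mult_le) auto
    qed
    show "((\<lambda>x. 9 / 2 * \<bar>q x powr (- 2 / 3) - 1\<bar>) \<longlongrightarrow> 0) at_top"
      using tendsto_mult[OF tendsto_const[of "9 / 2"] tendsto_rabs[OF tendsto_diff[OF q tendsto_const[of 1]]]] by simp
  qed
  from tendsto_add[OF this tendsto_mult[OF e q]]
  have "((\<lambda>x. 3 / 2 * g x * (q x powr (- 2 / 3) - 1) + (char_value (char_coord (x, 2)) / (A x)\<^sup>2 - 3 / 2 * g x) * q x powr (- 2 / 3)) \<longlongrightarrow> 0) at_top"
    by simp
  moreover have "\<forall>\<^sub>F x in at_top. 3 / 2 * g x * (q x powr (- 2 / 3) - 1) + (char_value (char_coord (x, 2)) / (A x)\<^sup>2 - 3 / 2 * g x) * q x powr (- 2 / 3)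
      = cf_sol (x, 0) / x powr (2 / 3) - 3 / 2 * g x"
    using pos
  proof eventually_elim
    case (elim x)
    note a = c(3)[OF elim]
    have qp: "0 < q x" using char_dom_bounds(3)[OF c(1)[OF elim]] a by (simp add: q_def)
    have "x = A x ^ 3 * q x"
      using c(2)[OF elim] a by (simp add: char_place_def A_def q_def power2_eq_square power3_eq_cube)
    then have "x powr (2 / 3) = (A x ^ 3) powr (2 / 3) * q x powr (2 / 3)"
      using powr_mult[of "A x ^ 3" "q x" "2 / 3"] by simp
    also have "(A x ^ 3) powr (2 / 3) = (A x)\<^sup>2"
    proof -
      have "(A x powr 3) powr (2 / 3) = A x powr 2" unfolding powr_powr by simp
      then show ?thesis using a by simp
    qed
    finally have "cf_sol (x, 0) / x powr (2 / 3) = char_value (char_coord (x, 2)) / (A x)\<^sup>2 * q x powr (- 2 / 3)"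
      using elim powr_minus_divide[of "q x" "2 / 3"] by (simp add: cf_sol_def sol_def)
    then show ?case by (simp add: algebra_simps)
  qed
  ultimately show ?thesis unfolding g_def by (rule Lim_transform_eventually)
qed

text \<open>Every late exit time occurs far out at the initial time, so all phases of \<open>sin (ln \<tau>)\<close> are seen there.\<close>
lemma far_field_phase:
  assumes "2 + 20 * (M + M\<^sup>2 + M ^ 3) < \<tau>" "0 \<le> M"
  obtains x where "M / 2 \<le> x" "0 < x" "snd (char_coord (x, 2)) = \<tau>"
proof -
  have "0 \<le> M + M\<^sup>2 + M ^ 3" using assms by simp
  then have \<tau>: "2 < \<tau>" using assms by argo
  define A where "A = 2 * root 3 \<tau>"
  have A: "A > 0" "A ^ 3 = 8 * \<tau>" using \<tau> by (auto simp: A_def power_mult_distrib)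
  have D: "(a, \<tau>) \<in> char_dom" if "0 \<le> a" "a \<le> A" for a
    using power_mono[of a A 3] A \<tau> that by (auto simp: char_dom_def)
  have "continuous_on {0..A} (\<lambda>a. char_time (a, \<tau>))"
    by (rule DERIV_continuous_on[OF has_field_derivative_at_within], rule partials_from_has_derivative(1)[OF char_dom_has_derivative(3)])
      (use D in auto)
  moreover have "osc_int (0, \<tau>) \<le> 0" using char_dom_bounds(7)[OF D[of 0]] A by simp
  then have "2 \<le> char_time (0, \<tau>)" using \<tau> by (simp add: char_time_def)
  moreover have "char_time (A, \<tau>) \<le> 2" using char_time_boundary[OF D[of A]] A by auto
  ultimately obtain a where a: "0 \<le> a" "a \<le> A" "char_time (a, \<tau>) = 2"
    using IVT2'[of "\<lambda>a. char_time (a, \<tau>)" A 2 0] A by auto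
  have "M < a"
  proof (rule ccontr)
    assume "\<not> M < a"
    then have "a + a\<^sup>2 + a ^ 3 \<le> M + M\<^sup>2 + M ^ 3" using a by (intro add_mono power_mono) auto
    then show False using char_dom_bounds(7)[OF D[OF a(1,2)]] a(3) assms by (simp add: char_time_def)
  qed
  have "1 * 1 \<le> (1 + a) * (1 + a)" using a by (intro mult_mono) auto
  then have "1 / 2 \<le> osc_sq (a, \<tau>)" using char_dom_bounds(1)[OF D[OF a(1,2)]] by (simp add: power2_eq_square)
  then have "a * (1 / 2) \<le> char_place (a, \<tau>)" unfolding char_place_def fst_conv using a by (intro mult_left_mono)
  moreover have "char_coord (char_place (a, \<tau>), 2) = (a, \<tau>)" using char_coord_param[OF D[OF a(1,2)]] a(3) by (simp add: char_param_def)
  ultimately show thesis using that[of "char_place (a, \<tau>)"] \<open>M < a\<close> assms by auto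
qed

lemma cf_sol_0_frequently:
  assumes "\<And>B. \<exists>\<tau>\<ge>B. sin (ln \<tau>) = s"
  shows "\<exists>\<^sub>F x in at_top. \<bar>cf_sol (x, 0) / x powr (2 / 3) - (3 + 3 / 2 * slow * s)\<bar> < slow / 2"
  unfolding frequently_def
proof
  assume "\<forall>\<^sub>F x in at_top. \<not> \<bar>cf_sol (x, 0) / x powr (2 / 3) - (3 + 3 / 2 * slow * s)\<bar> < slow / 2"
  moreover have "\<forall>\<^sub>F x in at_top. \<bar>cf_sol (x, 0) / x powr (2 / 3) - 3 / 2 * amp (snd (char_coord (x, 2)))\<bar> < slow / 2"
    using tendstoD[OF far_field, of "slow / 2"] by (simp add: dist_real_def slow_def)
  ultimately have "\<forall>\<^sub>F x in at_top. sin (ln (snd (char_coord (x, 2)))) \<noteq> s"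
    by eventually_elim (auto simp: amp_def algebra_simps)
  then obtain N where N: "\<And>x. N \<le> x \<Longrightarrow> sin (ln (snd (char_coord (x, 2)))) \<noteq> s"
    by (auto simp: eventually_at_top_linorder)
  define M where "M = 2 * \<bar>N\<bar>"
  obtain \<tau> where \<tau>: "2 + 20 * (M + M\<^sup>2 + M ^ 3) + 1 \<le> \<tau>" "sin (ln \<tau>) = s" using assms by blast
  have M: "2 + 20 * (M + M\<^sup>2 + M ^ 3) < \<tau>" "0 \<le> M"
    using \<tau>(1) by (simp_all add: M_def)
  obtain x where x: "M / 2 \<le> x" "snd (char_coord (x, 2)) = \<tau>"
    by (rule far_field_phase[OF M])
  then have "N \<le> x" using abs_ge_self[of N] unfolding M_def by simp
  then show False using N[of x] \<tau>(2) x(2) by simp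
qed

lemma cf_sol_0_Liminf_Limsup:
  defines "f \<equiv> \<lambda>x. ereal (cf_sol (x, 0) / x powr (2 / 3))"
  shows "0 < Liminf at_top f" "Liminf at_top f < Limsup at_top f" "Limsup at_top f < \<infinity>"
proof -
  have ev: "\<forall>\<^sub>F x in at_top. 1 \<le> cf_sol (x, 0) / x powr (2 / 3) \<and> cf_sol (x, 0) / x powr (2 / 3) \<le> 5"
    using tendstoD[OF far_field half_gt_zero[OF zero_less_one]] eventually_gt_at_top[of 0]
  proof eventually_elim
    case (elim x)
    have "char_coord (x, 2) \<in> char_dom" using char_coord(1)[of "(x, 2)"] elim char_dom_int_subset by auto
    from char_value_expand(3,4)[OF this] elim(1) show ?case unfolding dist_real_def by argo
  qed
  have "1 \<le> Liminf at_top f"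
    unfolding f_def by (rule Liminf_bounded) (use ev in \<open>auto elim: eventually_mono\<close>)
  then show "0 < Liminf at_top f" by (rule less_le_trans[rotated]) simp
  have "Limsup at_top f \<le> 5"
    unfolding f_def by (rule Limsup_bounded) (use ev in \<open>auto elim: eventually_mono\<close>)
  then show "Limsup at_top f < \<infinity>" by (rule le_less_trans) simp
  have "Liminf at_top f \<le> ereal (3 - slow)"
  proof (rule ccontr)
    assume "\<not> ?thesis"
    then have "\<forall>\<^sub>F x in at_top. ereal (3 - slow) < f x" by (intro less_LiminfD) simp
    then have "\<forall>\<^sub>F x in at_top. \<not> \<bar>cf_sol (x, 0) / x powr (2 / 3) - (3 + 3 / 2 * slow * - 1)\<bar> < slow / 2"
      by eventually_elim (unfold f_def less_ereal.simps abs_less_iff, argo)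
    then show False using cf_sol_0_frequently[OF sin_ln_extremal(2)] unfolding frequently_def by blast
  qed
  moreover have "ereal (3 + slow) \<le> Limsup at_top f"
  proof (rule ccontr)
    assume "\<not> ?thesis"
    then have "\<forall>\<^sub>F x in at_top. f x < ereal (3 + slow)" by (intro Limsup_lessD) simp
    then have "\<forall>\<^sub>F x in at_top. \<not> \<bar>cf_sol (x, 0) / x powr (2 / 3) - (3 + 3 / 2 * slow * 1)\<bar> < slow / 2"
      by eventually_elim (unfold f_def less_ereal.simps abs_less_iff, argo)
    then show False using cf_sol_0_frequently[OF sin_ln_extremal(1)] unfolding frequently_def by blast
  qed
  moreover have "ereal (3 - slow) < ereal (3 + slow)" by (simp add: slow_def)
  ultimately show "Liminf at_top f < Limsup at_top f" by (meson le_less_trans less_le_trans)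
qed


section \<open>Oscillation for large times\<close>

text \<open>The characteristic with exit time \<open>\<tau>\<close> passes \<open>x = 1\<close> at a bounded time before \<open>\<tau>\<close>.\<close>
lemma near_field_phase:
  assumes "300 + \<bar>T\<bar> \<le> \<tau>"
  obtains t where "T \<le> t" "0 \<le> t" "snd (char_coord (1, t + 2)) = \<tau>"
proof -
  have D: "(a, \<tau>) \<in> char_dom" if "0 \<le> a" "a \<le> 2" for a
    using power_mono[of a 2 3] assms that by (auto simp: char_dom_def)
  have "continuous_on {0..2} (\<lambda>a. char_place (a, \<tau>))"
    by (rule DERIV_continuous_on[OF has_field_derivative_at_within], rule partials_from_has_derivative(1)[OF char_dom_has_derivative(4)])
      (use D in auto)
  moreover have "1 \<le> char_place (2, \<tau>)" using char_dom_bounds(1)[OF D[of 2]] by (simp add: char_place_def)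
  moreover have "char_place (0, \<tau>) \<le> 1" by (simp add: char_place_def)
  ultimately obtain a where a: "0 \<le> a" "a \<le> 2" "char_place (a, \<tau>) = 1"
    using IVT'[of "\<lambda>a. char_place (a, \<tau>)" 0 1 2] by auto
  have "a + a\<^sup>2 + a ^ 3 \<le> 2 + 2\<^sup>2 + 2 ^ 3" using a by (intro add_mono power_mono) auto
  then have "\<tau> - 280 \<le> char_time (a, \<tau>)" using char_dom_bounds(7)[OF D[OF a(1,2)]] by (simp add: char_time_def)
  moreover have "char_coord (1, char_time (a, \<tau>)) = (a, \<tau>)" using char_coord_param[OF D[OF a(1,2)]] a(3) by (simp add: char_param_def)
  ultimately show thesis using that[of "char_time (a, \<tau>) - 2"] assms by auto
qed

text \<open>At \<open>x = 1\<close> the parameter \<open>a\<close> stays in a compact interval, hence \<open>w\<close> and the rate \<open>w a\<^sup>2 / 8\<close> tend to 0 with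
  the exit time. If the value converges, the equation makes the slope converge. The limits of the slope, which is
  \<open>1 - a / (g + a)\<close> up to a null sequence, and of \<open>a (g + a)\<^sup>2\<close>, which is 1, determine \<open>g + a\<close>,
  then \<open>a\<close> and finally \<open>g\<close>. But \<open>g\<close> keeps returning to both of its extreme values.\<close>
lemma no_limit: "\<not> ((\<lambda>t. cf_sol (1, t)) \<longlongrightarrow> L) at_top"
proof
  assume L: "((\<lambda>t. cf_sol (1, t)) \<longlongrightarrow> L) at_top"
  define z where "z t = char_coord (1, t + 2)" for t :: real
  define a where "a t = fst (z t)" for t
  define h where "h t = amp (snd (z t)) + a t" for t
  define w where "w t = freq (snd (z t))" for t
  define p where "p t = char_slope (z t)" for t
  have ev: "\<forall>\<^sub>F t::real in at_top. 0 \<le> t" by (rule eventually_ge_at_top)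
  have D: "z t \<in> char_dom" "a t * osc_sq (z t) = 1" "char_time (z t) = t + 2" if "0 \<le> t" for t
    using char_coord[of "(1, t + 2)"] that char_dom_int_subset by (auto simp: char_param_def char_place_def z_def a_def)
  have a: "1 / 180 \<le> a t" "a t \<le> 2" if "0 \<le> t" for t
  proof -
    have a0: "0 \<le> a t" using D(1)[OF that] by (simp add: char_dom_def a_def)
    have "1 * 1 \<le> (1 + a t) * (1 + a t)" using a0 by (intro mult_mono) auto
    then have "1 / 2 \<le> osc_sq (z t)" using char_dom_bounds(1)[OF D(1)[OF that]] by (simp add: power2_eq_square a_def)
    then have "a t * (1 / 2) \<le> a t * osc_sq (z t)" using a0 by (intro mult_left_mono)
    then show le: "a t \<le> 2" using D(2)[OF that] by simp
    have "osc_sq (z t) \<le> 20 * (1 + a t)\<^sup>2" using char_dom_bounds(2)[OF D(1)[OF that]] by (simp add: a_def)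
    also have "\<dots> \<le> 20 * 3\<^sup>2" using a0 le by (intro mult_left_mono power_mono) auto
    finally have "a t * osc_sq (z t) \<le> a t * 180" using a0 by (intro mult_left_mono) auto
    then show "1 / 180 \<le> a t" using D(2)[OF that] by simp
  qed
  have est: "\<bar>w t\<bar> \<le> 1 / t" "\<bar>osc_sq (z t) - (h t)\<^sup>2\<bar> \<le> 300 * \<bar>w t\<bar>" "\<bar>osc_half (z t) - h t\<bar> \<le> 100 * \<bar>w t\<bar>"
    "1 \<le> h t" "h t \<le> 5" "1 / 2 \<le> osc_sq (z t)" if t: "0 < t" for t
  proof -
    have t0: "0 \<le> t" using t by simp
    note a = a[OF t0] and D = D[OF t0]
    interpret char_domain_t "a t" "snd (z t)" "amp (snd (z t))" "w t" "amp' (snd (z t))" "freq' (snd (z t))"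
      using char_dom_is_char_domain[OF D(1)] by (simp add: a_def w_def)
    have "0 \<le> fst (z t) ^ 3" using a0 by (simp add: a_def)
    then have "0 \<le> osc_int (z t)" using char_dom_bounds(6)[OF D(1)] by argo
    then have "t \<le> snd (z t)" using D(3) by (simp add: char_time_def)
    then have "12 * slow / snd (z t) \<le> 1 / t" using t by (intro frac_le) (auto simp: slow_def)
    with char_domain_axioms show "\<bar>w t\<bar> \<le> 1 / t" unfolding char_domain_def by linarith
    show "1 \<le> h t" "h t \<le> 5" using g a0 a by (auto simp: h_def)
    have "1 * 1 \<le> (1 + a t) * (1 + a t)" using a0 by (intro mult_mono) auto
    then show "1 / 2 \<le> osc_sq (z t)" using char_dom_bounds(1)[OF D(1)] by (simp add: power2_eq_square a_def)
    have ufun: "\<bar>w t * ufun k (w t) (a t)\<bar> \<le> 3 * (2 ^ k * \<bar>w t\<bar>)" for k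
    proof -
      have "\<bar>w t\<bar> * a t ^ k \<le> \<bar>w t\<bar> * 2 ^ k" using a a0 by (intro mult_left_mono power_mono) auto
      then show ?thesis using w_ufun_le[of k] by (simp add: mult.commute)
    qed
    have osc_sq: "osc_sq (z t) = ysq (amp (snd (z t))) (w t) (a t)" "osc_half (z t) = ydy (amp (snd (z t))) (w t) (a t)"
      by (simp_all add: osc_sq_def osc_half_def w_def a_def)
    show "\<bar>osc_sq (z t) - (h t)\<^sup>2\<bar> \<le> 300 * \<bar>w t\<bar>"
      using abs_mult_le[OF ufun[of 2] g_sq(2)] abs_mult_le[OF ufun[of 3] g_sq(1)] ufun[of 4]
      unfolding osc_sq h_def ysq_expand by (simp add: abs_le_iff)
    show "\<bar>osc_half (z t) - h t\<bar> \<le> 100 * \<bar>w t\<bar>"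
      using abs_mult_le[OF ufun[of 2] g_sq(1)] abs_mult_le[OF ufun[of 1] g_sq(2)] ufun[of 3]
      unfolding osc_sq h_def ydy_expand by (simp add: abs_le_iff)
  qed
  have evp: "\<forall>\<^sub>F t::real in at_top. 0 < t" by (rule eventually_gt_at_top)
  have "((\<lambda>t. 1 / t :: real) \<longlongrightarrow> 0) at_top"
    by (rule tendsto_divide_0[OF tendsto_const filterlim_at_top_imp_at_infinity[OF filterlim_ident]])
  then have w: "((\<lambda>t. \<bar>w t\<bar>) \<longlongrightarrow> 0) at_top"
    by (rule Lim_null_comparison[rotated]) (use eventually_mono[OF evp est(1)] in simp)
  have small: "(f \<longlongrightarrow> 0) at_top" if "\<And>t. 0 < t \<Longrightarrow> \<bar>f t\<bar> \<le> C * \<bar>w t\<bar>" for f :: "real \<Rightarrow> real" and C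
  proof (rule Lim_null_comparison)
    show "\<forall>\<^sub>F t in at_top. norm (f t) \<le> C * \<bar>w t\<bar>" using evp by eventually_elim (simp add: that)
    show "((\<lambda>t. C * \<bar>w t\<bar>) \<longlongrightarrow> 0) at_top" using tendsto_mult[OF tendsto_const[of C] w] by simp
  qed
  have "((\<lambda>t. char_rate (z t)) \<longlongrightarrow> 0) at_top"
  proof (rule small)
    fix t :: real assume t: "0 < t"
    have "(a t)\<^sup>2 \<le> 2\<^sup>2" using a[of t] t by (intro power_mono) auto
    then have "\<bar>w t\<bar> * (a t)\<^sup>2 \<le> \<bar>w t\<bar> * 4" by (intro mult_left_mono) auto
    then show "\<bar>char_rate (z t)\<bar> \<le> 1 * \<bar>w t\<bar>"
      by (simp add: char_rate_def abs_mult flip: w_def a_def)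
  qed
  then have q: "((\<lambda>t. sqrt (2 * (1 - char_rate (z t) - cf_sol (1, t)) + 1 / 4)) \<longlongrightarrow> sqrt (2 * (1 - 0 - L) + 1 / 4)) at_top"
    by (intro tendsto_intros L)
  (* The equation is quadratic in the slope; p \<le> 1 selects the root. *)
  have sqrt_eq: "sqrt (2 * (1 - char_rate (z t) - cf_sol (1, t)) + 1 / 4) = 3 / 2 - p t" if t: "0 < t" for t
  proof -
    have "cf_operator (1, t) (cf_sol (1, t)) (cf_sol_x (1, t)) (cf_sol_t (1, t)) = 0" using eq[of "(1, t)"] t by simp
    then have "char_rate (z t) + 1 / 2 * (p t - 1) * (p t - 2) + cf_sol (1, t) - 1 = 0"
      by (simp add: cf_operator_def cf_sol_x_def cf_sol_t_def sol_x_def sol_t_def p_def z_def)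
    then have "2 * (1 - char_rate (z t) - cf_sol (1, t)) + 1 / 4 = (3 / 2 - p t)\<^sup>2"
      by (simp add: power2_eq_square field_simps)
    moreover have "p t \<le> 1"
      using sol_properties(5)[of 1 "t + 2"] t by (simp add: sol_x_def p_def z_def)
    ultimately show ?thesis by simp
  qed
  obtain R where "((\<lambda>t. 1 - p t) \<longlongrightarrow> R) at_top"
  proof -
    have "((\<lambda>t. 3 / 2 - p t) \<longlongrightarrow> sqrt (2 * (1 - 0 - L) + 1 / 4)) at_top"
      by (rule Lim_transform_eventually[OF q eventually_mono[OF evp sqrt_eq]])
    from tendsto_diff[OF this tendsto_const[of "1 / 2"]] show thesis using that by (simp add: algebra_simps)
  qed
  moreover have "((\<lambda>t. a t / h t - (1 - p t)) \<longlongrightarrow> 0) at_top"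
  proof (rule small)
    fix t :: real assume t: "0 < t"
    note e = est[OF t]
    have "a t / h t - (1 - p t) = a t * (osc_sq (z t) - h t * osc_half (z t)) / (h t * osc_sq (z t))"
      using e by (simp add: p_def char_slope_def field_simps flip: a_def)
    moreover have "\<bar>a t * (osc_sq (z t) - h t * osc_half (z t))\<bar> \<le> 2 * (800 * \<bar>w t\<bar>)"
    proof (rule abs_mult_le)
      have "\<bar>h t * (osc_half (z t) - h t)\<bar> \<le> 5 * (100 * \<bar>w t\<bar>)" using e by (intro abs_mult_le e(3)) auto
      moreover have "osc_sq (z t) - h t * osc_half (z t) = (osc_sq (z t) - (h t)\<^sup>2) - h t * (osc_half (z t) - h t)"
        by (simp add: power2_eq_square algebra_simps)
      ultimately show "\<bar>osc_sq (z t) - h t * osc_half (z t)\<bar> \<le> 800 * \<bar>w t\<bar>" using e(2) by linarith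
      show "\<bar>a t\<bar> \<le> 2" using a[of t] t by simp
    qed
    moreover have "1 * (1 / 2) \<le> h t * osc_sq (z t)" using e by (intro mult_mono) auto
    ultimately have "\<bar>a t / h t - (1 - p t)\<bar> \<le> 2 * (800 * \<bar>w t\<bar>) / (1 / 2)"
      by (simp only: abs_divide) (intro frac_le, auto)
    then show "\<bar>a t / h t - (1 - p t)\<bar> \<le> 3200 * \<bar>w t\<bar>" by simp
  qed
  ultimately have R: "((\<lambda>t. a t / h t) \<longlongrightarrow> R) at_top" using tendsto_add[of "\<lambda>t. a t / h t - (1 - p t)" 0 at_top "\<lambda>t. 1 - p t" R] by simp
  have "1 / 900 \<le> R"
  proof (rule tendsto_lowerbound[OF R])
    show "\<forall>\<^sub>F t in at_top. 1 / 900 \<le> a t / h t"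
      using evp
    proof eventually_elim
      case (elim t)
      then have "(1 / 180) / 5 \<le> a t / h t" using est[OF elim] a[of t] by (intro frac_le) auto
      then show ?case by simp
    qed
  qed simp
  then have R0: "R \<noteq> 0" by auto
  have "((\<lambda>t. a t * (h t)\<^sup>2 - 1) \<longlongrightarrow> 0) at_top"
  proof (rule small)
    fix t :: real assume t: "0 < t"
    have "\<bar>a t * (osc_sq (z t) - (h t)\<^sup>2)\<bar> \<le> 2 * (300 * \<bar>w t\<bar>)"
      using a[of t] t by (intro abs_mult_le est(2)) auto
    moreover have "a t * (h t)\<^sup>2 - 1 = - (a t * (osc_sq (z t) - (h t)\<^sup>2))"
      using D(2)[of t] t by (simp add: algebra_simps)
    ultimately show "\<bar>a t * (h t)\<^sup>2 - 1\<bar> \<le> 600 * \<bar>w t\<bar>" by simp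
  qed
  then have "((\<lambda>t. a t * (h t)\<^sup>2) \<longlongrightarrow> 1) at_top" by (rule LIM_zero_cancel)
  from tendsto_real_root[OF tendsto_divide[OF this R R0], of 3]
  have "((\<lambda>t. root 3 (a t * (h t)\<^sup>2 / (a t / h t))) \<longlongrightarrow> root 3 (1 / R)) at_top" .
  then have H: "(h \<longlongrightarrow> root 3 (1 / R)) at_top"
  proof (rule Lim_transform_eventually)
    show "\<forall>\<^sub>F t in at_top. root 3 (a t * (h t)\<^sup>2 / (a t / h t)) = h t"
      using evp
    proof eventually_elim
      case (elim t)
      then have "a t > 0" "h t > 0" using est(4)[OF elim] a[of t] by auto
      then have "a t * (h t)\<^sup>2 / (a t / h t) = h t ^ 3" by (simp add: field_simps power2_eq_square power3_eq_cube)
      then show ?case using \<open>h t > 0\<close> by (simp add: real_root_power_cancel)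
    qed
  qed
  define g where "g = root 3 (1 / R) - R * root 3 (1 / R)"
  have "((\<lambda>t. h t - a t / h t * h t) \<longlongrightarrow> g) at_top"
    unfolding g_def by (intro tendsto_intros H R)
  then have "((\<lambda>t. amp (snd (z t))) \<longlongrightarrow> g) at_top"
  proof (rule Lim_transform_eventually)
    show "\<forall>\<^sub>F t in at_top. h t - a t / h t * h t = amp (snd (z t))"
      using evp
    proof eventually_elim
      case (elim t)
      then show ?case using est(4)[OF elim] by (simp add: h_def)
    qed
  qed
  from tendstoD[OF this, of slow] obtain T where T: "\<And>t. T \<le> t \<Longrightarrow> \<bar>amp (snd (z t)) - g\<bar> < slow"
    by (auto simp: eventually_at_top_linorder dist_real_def slow_def)
  have "\<bar>2 + slow * s - g\<bar> < slow" if ex: "\<And>B. \<exists>\<tau>\<ge>B. sin (ln \<tau>) = s" for s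
  proof -
    obtain \<tau> where \<tau>: "300 + \<bar>T\<bar> \<le> \<tau>" "sin (ln \<tau>) = s" using ex by blast
    obtain t where "T \<le> t" "0 \<le> t" "snd (z t) = \<tau>" using near_field_phase[OF \<tau>(1)] unfolding z_def by blast
    then show ?thesis using T[of t] \<tau>(2) by (simp add: amp_def)
  qed
  from this[OF sin_ln_extremal(1)] this[OF sin_ln_extremal(2)] show False by (simp add: abs_less_iff)
qed

theorem theorem1p6:
  "\<exists>F0 :: real \<Rightarrow> real.
     (\<exists>C. C-lipschitz_on {0..} F0) \<and>
     (\<forall>x\<ge>0. 0 \<le> F0 x \<and> F0 x \<le> x) \<and>
     sublinear F0 \<and>
     (AE x in lebesgue. 0 < x \<longrightarrow>
        F0 differentiable at x \<and> 0 \<le> deriv F0 x \<and> deriv F0 x \<le> 1) \<and>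
     0 < Liminf at_top (\<lambda>x. ereal (F0 x / x powr (2/3))) \<and>
     Liminf at_top (\<lambda>x. ereal (F0 x / x powr (2/3))) < Limsup at_top (\<lambda>x. ereal (F0 x / x powr (2/3))) \<and>
     Limsup at_top (\<lambda>x. ereal (F0 x / x powr (2/3))) < \<infinity> \<and>
     (\<exists>F. cf_solution F0 F \<and>
          (\<forall>G. cf_solution F0 G \<longrightarrow> (\<forall>x\<ge>0. \<forall>t\<ge>0. G (x, t) = F (x, t))) \<and>
          (\<exists>x0>0. \<not> (\<exists>L. ((\<lambda>t. F (x0, t)) \<longlongrightarrow> L) at_top)))"
proof (intro exI[of _ "\<lambda>x. cf_sol (x, 0)"] conjI)
  show "\<exists>C. C-lipschitz_on {0..} (\<lambda>x. cf_sol (x, 0))" using cf_sol_0_lipschitz by blast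
  show "\<forall>x\<ge>0. 0 \<le> cf_sol (x, 0) \<and> cf_sol (x, 0) \<le> x" using between by simp
  show "sublinear (\<lambda>x. cf_sol (x, 0))" by (rule sublinear_F) simp
  show "AE x in lebesgue. 0 < x \<longrightarrow> (\<lambda>x. cf_sol (x, 0)) differentiable at x \<and>
      0 \<le> deriv (\<lambda>x. cf_sol (x, 0)) x \<and> deriv (\<lambda>x. cf_sol (x, 0)) x \<le> 1"
  proof (intro AE_I2 impI)
    fix x :: real assume "0 < x"
    note d = cf_sol_0_deriv[OF this]
    show "(\<lambda>x. cf_sol (x, 0)) differentiable at x \<and>
      0 \<le> deriv (\<lambda>x. cf_sol (x, 0)) x \<and> deriv (\<lambda>x. cf_sol (x, 0)) x \<le> 1"
      using d(2,3) DERIV_imp_deriv[OF d(1)] real_differentiable_def[THEN iffD2, OF exI, OF d(1)] by simp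
  qed
  show "0 < Liminf at_top (\<lambda>x. ereal (cf_sol (x, 0) / x powr (2 / 3)))"
    "Liminf at_top (\<lambda>x. ereal (cf_sol (x, 0) / x powr (2 / 3)))
      < Limsup at_top (\<lambda>x. ereal (cf_sol (x, 0) / x powr (2 / 3)))"
    "Limsup at_top (\<lambda>x. ereal (cf_sol (x, 0) / x powr (2 / 3))) < \<infinity>"
    by (rule cf_sol_0_Liminf_Limsup)+
  show "\<exists>F. cf_solution (\<lambda>x. cf_sol (x, 0)) F \<and>
      (\<forall>G. cf_solution (\<lambda>x. cf_sol (x, 0)) G \<longrightarrow> (\<forall>x\<ge>0. \<forall>t\<ge>0. G (x, t) = F (x, t))) \<and>
      (\<exists>x0>0. \<not> (\<exists>L. ((\<lambda>t. F (x0, t)) \<longlongrightarrow> L) at_top))"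
    using cf_solution_unique no_limit by (intro exI[of _ cf_sol] conjI exI[of _ 1]) auto
qed

end
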